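(* Let $F\colon\mathbb{R}^d\to\mathbb{R}^m$ and $G=(G_1,\ldots,G_n)\colon\mathbb{R}^d\to\mathbb{R}^n$ be piecewise affine functions, let $\Omega=\{x\in\mathbb{R}^d\mid F(x)=0,\ G(x)\le 0\}$ (the inequality being coordinate-wise) be nonempty, let $V\subset\mathbb{R}^d$ be a given set, and let $\|\cdot\|$ be an arbitrary norm on $\mathbb{R}^m$. Put $$\varphi(x)=\|F(x)\|+\sum_{i=1}^n\max\{G_i(x),0\},\qquad x\in\mathbb{R}^d.$$ Then the inequality $$\tau\operatorname{dist}(x,\Omega)\le\varphi(x)\quad\forall x\in V\qquad( * )$$ is satisfied for some $\tau>0$, provided one of the following five conditions holds true: 1. $V$ is bounded; 2. $V$ is unbounded and $\liminf_{\|x\|\to+\infty,\,x\in V}\varphi(x)/\|x\|>0$; 3. $V$ is a cone and $\varphi$ is coercive on $V$; 4. $V=\mathbb{R}^d$ and both $F$ and $G$ are positively homogeneous; 5. $V$ is a finite union of polyhedral sets and $S(\varphi^\infty)\cap 0^+V\subseteq 0^+\Omega$. Furthermore, if $V$ is a finite union of polyhedral sets, then the inclusion $S(\varphi^\infty)\cap 0^+V\subseteq 0^+\Omega$ is also necessary for $( * )$ to hold for some $\tau>0$. If $0^+\Omega\cap\operatorname{cl}\operatorname{cone}V=\{0\}$ and $( * )$ holds for some $\tau>0$, then: when $V$ is unbounded, the inequality in condition 2 holds; and when $V$ is a cone, $\varphi$ is coercive on $V$.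
   Context: $\mathbb{R}^d$ is equipped with an arbitrary norm, also denoted $\|\cdot\|$; $\operatorname{dist}(x,Q)=\inf_{y\in Q}\|x-y\|$. A set is polyhedral if it is the intersection of finitely many closed half-spaces. A function $H\colon\mathbb{R}^d\to\mathbb{R}^k$ is piecewise affine if there are finitely many polyhedral sets $Q_1,\ldots,Q_s$ with nonempty, pairwise disjoint interiors covering $\mathbb{R}^d$ and affine functions $H_1,\ldots,H_s\colon\mathbb{R}^d\to\mathbb{R}^k$ such that $H=H_l$ on $Q_l$ for each $l$. The recession function of $\varphi$ is $\varphi^\infty(x)=\lim_{\lambda\to+\infty}\varphi(\lambda x)/\lambda$ (this limit exists), and $S(\varphi^\infty)=\{x\in\mathbb{R}^d\mid\varphi^\infty(x)\le 0\}$. A function $\varphi$ is coercive on $V$ if $\varphi(x_n)\to+\infty$ for any sequence $\{x_n\}\subset V$ such that $\|x_n\|\to+\infty$. A map $H$ is positively homogeneous if $H(\lambda x)=\lambda H(x)$ for all $x$ and $\lambda>0$. A cone is a nonempty set $K$ (not necessarily convex or closed) with $tx\in K$ for all $x\in K$, $t\ge 0$; for nonempty $V$, $\operatorname{cone}V$ is the smallest cone containing $V$; $\operatorname{cl}$ denotes closure. The recession cone $0^+Q$ of a nonempty set $Q\subseteq\mathbb{R}^d$ is the set of all $z\in\mathbb{R}^d$ for which there exists $x\in Q$ such that $x+\lambda z\in Q$ for all $\lambda\ge 0$. *)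

theory Defs
  imports "HOL-Analysis.Analysis"
begin

text \<open>
  The space \<open>\<real>\<^sup>d\<close> is rendered as \<open>real ^ 'd\<close>; an arbitrary norm on it is an explicit function
  \<open>N\<close>, which need not be the Euclidean \<open>norm\<close> of the type.  All metric notions (distance,
  boundedness, passage to infinity, coercivity) are taken with respect to \<open>N\<close>.  Purely
  topological ones (interior, closure) are the library's, since every norm on
  a finite-dimensional space induces the same topology.
\<close>

definition is_norm :: "('a::real_vector \<Rightarrow> real) \<Rightarrow> bool" where
  "is_norm N \<longleftrightarrow>
     (\<forall>x. 0 \<le> N x) \<and> (\<forall>x. N x = 0 \<longleftrightarrow> x = 0) \<and>
     (\<forall>c x. N (c *\<^sub>R x) = \<bar>c\<bar> * N x) \<and>
     (\<forall>x y. N (x + y) \<le> N x + N y)"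

definition norm_infdist :: "('a::real_vector \<Rightarrow> real) \<Rightarrow> 'a \<Rightarrow> 'a set \<Rightarrow> real" where
  "norm_infdist N x Q = (INF y\<in>Q. N (x - y))"

definition norm_bounded :: "('a \<Rightarrow> real) \<Rightarrow> 'a set \<Rightarrow> bool" where
  "norm_bounded N V \<longleftrightarrow> (\<exists>B. \<forall>x\<in>V. N x \<le> B)"

definition coercive_on :: "('a \<Rightarrow> real) \<Rightarrow> 'a set \<Rightarrow> ('a \<Rightarrow> real) \<Rightarrow> bool" where
  "coercive_on N V \<phi> \<longleftrightarrow>
     (\<forall>x :: nat \<Rightarrow> 'a. (\<forall>n. x n \<in> V) \<and> filterlim (\<lambda>n. N (x n)) at_top sequentially
        \<longrightarrow> filterlim (\<lambda>n. \<phi> (x n)) at_top sequentially)"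

text \<open>The filter of the limit process \<open>N x \<rightarrow> +\<infinity>\<close>, \<open>x \<in> V\<close>; it is trivial iff \<open>V\<close> is bounded.\<close>

definition at_infinity_within :: "('a \<Rightarrow> real) \<Rightarrow> 'a set \<Rightarrow> 'a filter" where
  "at_infinity_within N V = inf (filtercomap N at_top) (principal V)"

definition affine_map :: "('a::real_vector \<Rightarrow> 'b::real_vector) \<Rightarrow> bool" where
  "affine_map h \<longleftrightarrow> (\<exists>L c. linear L \<and> (\<forall>x. h x = L x + c))"

definition piecewise_affine :: "('a::euclidean_space \<Rightarrow> 'b::real_vector) \<Rightarrow> bool" where
  "piecewise_affine H \<longleftrightarrow>
     (\<exists>(s::nat) (Q :: nat \<Rightarrow> 'a set) (h :: nat \<Rightarrow> 'a \<Rightarrow> 'b).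
        (\<forall>l\<in>{1..s}. polyhedron (Q l) \<and> interior (Q l) \<noteq> {}) \<and>
        disjoint_family_on (\<lambda>l. interior (Q l)) {1..s} \<and>
        (\<Union>l\<in>{1..s}. Q l) = UNIV \<and>
        (\<forall>l\<in>{1..s}. affine_map (h l) \<and> (\<forall>x\<in>Q l. H x = h l x)))"

definition finite_union_polyhedra :: "'a::euclidean_space set \<Rightarrow> bool" where
  "finite_union_polyhedra V \<longleftrightarrow> (\<exists>\<P>. finite \<P> \<and> (\<forall>P\<in>\<P>. polyhedron P) \<and> V = \<Union>\<P>)"

definition positively_homogeneous :: "('a::real_vector \<Rightarrow> 'b::real_vector) \<Rightarrow> bool" where
  "positively_homogeneous H \<longleftrightarrow> (\<forall>x. \<forall>c>0. H (c *\<^sub>R x) = c *\<^sub>R H x)"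

definition recession_fun :: "('a::real_vector \<Rightarrow> real) \<Rightarrow> 'a \<Rightarrow> real" where
  "recession_fun \<phi> x = Lim at_top (\<lambda>t::real. \<phi> (t *\<^sub>R x) / t)"

definition nonpos_set :: "('a \<Rightarrow> real) \<Rightarrow> 'a set" where
  "nonpos_set \<psi> = {x. \<psi> x \<le> 0}"

definition recession_cone :: "'a::real_vector set \<Rightarrow> 'a set" where
  "recession_cone Q = {z. \<exists>x\<in>Q. \<forall>t\<ge>0. x + t *\<^sub>R z \<in> Q}"

definition error_bound ::
    "('a::real_vector \<Rightarrow> real) \<Rightarrow> 'a set \<Rightarrow> 'a set \<Rightarrow> ('a \<Rightarrow> real) \<Rightarrow> real \<Rightarrow> bool" where
  "error_bound N \<Omega> V \<phi> \<tau> \<longleftrightarrow> (\<forall>x\<in>V. \<tau> * norm_infdist N x \<Omega> \<le> \<phi> x)"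

text \<open>
  The library predicate \<^const>\<open>cone\<close> also holds of the empty set, whereas a cone is required
  here to be nonempty.
\<close>

definition nonempty_cone :: "'a::real_vector set \<Rightarrow> bool" where
  "nonempty_cone K \<longleftrightarrow> K \<noteq> {} \<and> cone K"

end

theory Submission
  imports Defs
begin

text \<open>
  Refine the pieces of \<open>F\<close> and \<open>G\<close> to finitely many polyhedra on each of which \<open>\<phi>\<close> is comparable
  to the residual of a system of linear inequalities whose solutions are the points of \<open>\<Omega>\<close> in that
  piece. Hoffman's bound, with a constant independent of the right-hand side, then shows that either
  \<open>\<phi> x\<close> dominates \<open>dist x \<Omega>\<close> or it is bounded below by a positive constant (a piece that misses
  \<open>\<Omega>\<close> has an infeasible system, whose residual is bounded away from zero). Hence only the
  behaviour of \<open>\<phi>\<close> at infinity matters: linear growth on \<open>V\<close> suffices, homogeneity scales the local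
  bound up, and the recession condition is handled by Hoffman's bound for the homogenised systems.
  The converse statements follow since limits of \<open>x\<^sub>n / t\<^sub>n\<close> with \<open>t\<^sub>n \<rightarrow> \<infinity>\<close> and
  \<open>dist x\<^sub>n \<Omega> = o(t\<^sub>n)\<close> are recession directions of \<open>\<Omega>\<close>.
\<close>

subsection \<open>Hoffman's bound\<close>

text \<open>The obstacle is that \<open>\<phi>\<close> is in general neither convex nor homogeneous,
  and that the pieces are polyhedra rather than cones: scaling a point changes both its piece and
  the right-hand sides. A Hoffman constant that depends on the normals only is the remedy. With
  right-hand side 0 it places any point of a piece at bounded distance from a recession direction of
  that piece. This yields \<open>\<phi> (t *\<^sub>R x) \<le> K\<^sup>2 * t * \<phi> x + M\<close>
  for \<open>0 \<le> t \<le> 1\<close>, a substitute for homogeneity by which coercivity on a cone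
  becomes linear growth. Boundedness of \<open>V\<close>, a positive lower limit and coercivity are
  thereby all reduced to one statement: \<open>c * norm x \<le> \<phi> x\<close> on \<open>V\<close>
  outside a ball. The set \<open>\<Omega>\<close> is a union of polyhedra, and its recession cone is
  the union of the recession cones of the nonempty ones. An infeasible system also has recession
  directions, which may be foreign to \<open>\<Omega>\<close>; hence the recurring nonemptiness
  conditions. All estimates are Euclidean; another norm on the domain only changes constants, and
  the claims are existential in them.\<close>

lemma finite_uniform_pos:
  fixes P :: "'q \<Rightarrow> real \<Rightarrow> bool"
  assumes "finite S"
    and "\<And>q. q \<in> S \<Longrightarrow> \<exists>c>0. P q c"
    and mono: "\<And>q c c'. q \<in> S \<Longrightarrow> P q c \<Longrightarrow> 0 < c' \<Longrightarrow> c' \<le> c \<Longrightarrow> P q c'"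
  shows "\<exists>c>0. \<forall>q\<in>S. P q c"
proof -
  have "\<forall>q\<in>S. \<exists>c>0. P q c" using assms(2) by blast
  then obtain f where f: "\<And>q. q \<in> S \<Longrightarrow> f q > 0 \<and> P q (f q)" by metis
  define c where "c = Min (insert 1 (f ` S))"
  have "c > 0" unfolding c_def using \<open>finite S\<close> f by (subst Min_gr_iff) auto
  moreover have "P q c" if "q \<in> S" for q
    using mono[OF that, of "f q" c] f[OF that] \<open>c > 0\<close> \<open>finite S\<close> that by (simp add: c_def)
  ultimately show ?thesis by blast
qed

lemma finite_uniform_bound:
  fixes P :: "'q \<Rightarrow> real \<Rightarrow> bool"
  assumes "finite S"
    and "\<And>q. q \<in> S \<Longrightarrow> \<exists>M. P q M"
    and mono: "\<And>q M M'. q \<in> S \<Longrightarrow> P q M \<Longrightarrow> M \<le> M' \<Longrightarrow> P q M'"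
  shows "\<exists>M\<ge>0. \<forall>q\<in>S. P q M"
proof -
  have "\<forall>q\<in>S. \<exists>M. P q M" using assms(2) by blast
  then obtain f where f: "\<And>q. q \<in> S \<Longrightarrow> P q (f q)" by metis
  define M where "M = Max (insert 0 (f ` S))"
  have "M \<ge> 0" unfolding M_def using \<open>finite S\<close> by simp
  moreover have "P q M" if "q \<in> S" for q
    using mono[OF that f[OF that], of M] \<open>finite S\<close> that by (simp add: M_def)
  ultimately show ?thesis by blast
qed

text \<open>
  The hypothesis on \<open>d\<close> says that \<open>d\<close> lies in the polar of the cone \<open>{k. \<forall>j\<in>J. a j \<bullet> k \<le> 0}\<close>.
  Only \<open>0\<close> lies in both the cone and its polar, so compactness of the unit sphere gives \<open>c\<close>.
\<close>

lemma polar_cone_bound: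
  fixes a :: "'i \<Rightarrow> 'a::euclidean_space"
  assumes "finite J"
  shows "\<exists>c\<ge>0. \<forall>d r. (\<forall>k. (\<forall>j\<in>J. a j \<bullet> k \<le> 0) \<longrightarrow> d \<bullet> k \<le> 0) \<longrightarrow>
    0 \<le> r \<longrightarrow> (\<forall>j\<in>J. a j \<bullet> d \<le> r) \<longrightarrow> norm d \<le> c * r"
proof -
  define D where "D = {d. \<forall>k. (\<forall>j\<in>J. a j \<bullet> k \<le> 0) \<longrightarrow> d \<bullet> k \<le> 0}"
  define f where "f d = (\<Sum>j\<in>J. max (a j \<bullet> d) 0)" for d
  have "D = (\<Inter>k\<in>{k. \<forall>j\<in>J. a j \<bullet> k \<le> 0}. {d. d \<bullet> k \<le> 0})"
    by (auto simp: D_def)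
  moreover have "closed \<dots>"
    by (intro closed_INT ballI closed_Collect_le continuous_intros)
  ultimately have "compact (sphere 0 1 \<inter> D)"
    by (simp add: compact_Int_closed)
  have f_nonneg: "f d \<ge> 0" for d
    unfolding f_def by (intro sum_nonneg) auto
  have pos: "f d > 0" if "d \<in> sphere 0 1 \<inter> D" for d
  proof (rule ccontr)
    assume "\<not> f d > 0"
    with f_nonneg[of d] have "f d = 0" by simp
    then have "\<forall>j\<in>J. max (a j \<bullet> d) 0 = 0"
      unfolding f_def using \<open>finite J\<close> by (subst (asm) sum_nonneg_eq_0_iff) auto
    then have "\<forall>j\<in>J. a j \<bullet> d \<le> 0"
      by (metis max.cobounded1)
    then have "d \<bullet> d \<le> 0" using that by (auto simp: D_def)
    then have "d = 0" by (metis inner_gt_zero_iff not_le)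
    with that show False by simp
  qed
  have "\<exists>m>0. \<forall>d\<in>sphere 0 1 \<inter> D. m \<le> f d"
  proof (cases "sphere 0 1 \<inter> D = {}")
    case True
    then show ?thesis by (metis empty_iff zero_less_one)
  next
    case False
    have "continuous_on (sphere 0 1 \<inter> D) f"
      unfolding f_def by (intro continuous_intros)
    from continuous_attains_inf[OF \<open>compact (sphere 0 1 \<inter> D)\<close> False this] pos
    show ?thesis by blast
  qed
  then obtain m where "m > 0" and m: "\<And>d. d \<in> sphere 0 1 \<inter> D \<Longrightarrow> m \<le> f d"
    by blast
  \<comment> \<open>As \<open>f\<close> is positively homogeneous, its lower bound \<open>m\<close>
    on the unit vectors of \<open>D\<close> gives \<open>m * norm d \<le> f d\<close>, while
    \<open>f d\<close> is at most \<open>card J * r\<close>.\<close>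
  have "norm d \<le> real (card J) / m * r"
    if d: "\<forall>k. (\<forall>j\<in>J. a j \<bullet> k \<le> 0) \<longrightarrow> d \<bullet> k \<le> 0"
      and r: "0 \<le> r" "\<forall>j\<in>J. a j \<bullet> d \<le> r" for d r
  proof (cases "d = 0")
    case True
    then show ?thesis using r \<open>m > 0\<close> by simp
  next
    case False
    have "sgn d \<in> sphere 0 1 \<inter> D"
      using d False by (auto simp: D_def sgn_div_norm divide_simps mult_le_0_iff)
    then have "m \<le> f (sgn d)" by (rule m)
    also have "f (sgn d) = f d / norm d"
    proof -
      have "max (a j \<bullet> sgn d) 0 = max (a j \<bullet> d) 0 / norm d" for j
        using False by (auto simp: sgn_div_norm max_def field_simps zero_less_divide_iff divide_le_0_iff)
      then show ?thesis by (simp add: f_def sum_divide_distrib)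
    qed
    also have "f d \<le> (\<Sum>j\<in>J. r)"
      unfolding f_def using r by (intro sum_mono) auto
    finally have "m * norm d \<le> card J * r"
      using False by (simp add: field_simps divide_right_mono)
    then show ?thesis using \<open>m > 0\<close> by (simp add: field_simps)
  qed
  moreover have "real (card J) / m \<ge> 0" using \<open>m > 0\<close> by simp
  ultimately show ?thesis by blast
qed

lemma closed_convex_halfspaces:
  fixes a :: "'i \<Rightarrow> 'a::euclidean_space"
  shows "closed {y. \<forall>i\<in>I. a i \<bullet> y \<le> b i}" and "convex {y. \<forall>i\<in>I. a i \<bullet> y \<le> b i}"
proof -
  have *: "{y. \<forall>i\<in>I. a i \<bullet> y \<le> b i} = (\<Inter>i\<in>I. {y. a i \<bullet> y \<le> b i})" by blast
  show "closed {y. \<forall>i\<in>I. a i \<bullet> y \<le> b i}"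
    unfolding * by (intro closed_INT ballI closed_halfspace_le)
  show "convex {y. \<forall>i\<in>I. a i \<bullet> y \<le> b i}"
    unfolding * by (intro convex_INT convex_halfspace_le)
qed

text \<open>
  If \<open>y\<close> is the projection of \<open>x\<close>, then \<open>x - y\<close> is polar to the cone of the constraints active
  at \<open>y\<close>; there are only finitely many such cones, whatever the right-hand side \<open>b\<close>.
\<close>

lemma Hoffman:
  fixes a :: "'i \<Rightarrow> 'a::euclidean_space"
  assumes "finite I"
  obtains C where "C \<ge> 0"
    and "\<And>b x r. \<exists>y. \<forall>i\<in>I. a i \<bullet> y \<le> b i \<Longrightarrow> 0 \<le> r \<Longrightarrow> \<forall>i\<in>I. a i \<bullet> x \<le> b i + r \<Longrightarrow>
      \<exists>y. (\<forall>i\<in>I. a i \<bullet> y \<le> b i) \<and> norm (x - y) \<le> C * r"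
proof -
  define P where "P J c \<longleftrightarrow> (\<forall>d r. (\<forall>k. (\<forall>j\<in>J. a j \<bullet> k \<le> 0) \<longrightarrow> d \<bullet> k \<le> 0) \<longrightarrow>
    0 \<le> r \<longrightarrow> (\<forall>j\<in>J. a j \<bullet> d \<le> r) \<longrightarrow> norm d \<le> c * r)" for J c
  have "\<exists>C\<ge>0. \<forall>J\<in>Pow I. P J C"
  proof (rule finite_uniform_bound)
    show "\<exists>c. P J c" if "J \<in> Pow I" for J
      using polar_cone_bound[of J a] finite_subset[of J I] that assms unfolding P_def by blast
    show "P J c'" if "P J c" "c \<le> c'" for J c c'
      unfolding P_def
    proof (intro allI impI)
      fix d r assume "\<forall>k. (\<forall>j\<in>J. a j \<bullet> k \<le> 0) \<longrightarrow> d \<bullet> k \<le> 0" "0 \<le> r" "\<forall>j\<in>J. a j \<bullet> d \<le> r"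
      then have "norm d \<le> c * r" using that unfolding P_def by blast
      also have "\<dots> \<le> c' * r" using that \<open>0 \<le> r\<close> by (intro mult_right_mono)
      finally show "norm d \<le> c' * r" .
    qed
  qed (use assms in auto)
  then obtain C where "C \<ge> 0" and C: "\<And>J. J \<subseteq> I \<Longrightarrow> P J C" by blast
  show thesis
  proof (rule that[OF \<open>C \<ge> 0\<close>])
    fix b x and r :: real
    assume ne: "\<exists>y. \<forall>i\<in>I. a i \<bullet> y \<le> b i" and r: "0 \<le> r" "\<forall>i\<in>I. a i \<bullet> x \<le> b i + r"
    define S where "S = {y. \<forall>i\<in>I. a i \<bullet> y \<le> b i}"
    have S: "closed S" "convex S" "S \<noteq> {}"
      using closed_convex_halfspaces[of I a b] ne by (auto simp: S_def)
    define y where "y = closest_point S x"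
    have "y \<in> S" unfolding y_def using S by (intro closest_point_in_set)
    define J where "J = {i\<in>I. a i \<bullet> y = b i}"
    \<comment> \<open>An active constraint survives a step along \<open>k\<close> by the choice of
      \<open>k\<close>; an inactive one has slack and survives a small step. So
      \<open>y + e *\<^sub>R k\<close> is feasible for some \<open>e > 0\<close>, and the
      variational inequality of the projection applies to it.\<close>
    have "(x - y) \<bullet> k \<le> 0" if k: "\<forall>j\<in>J. a j \<bullet> k \<le> 0" for k
    proof -
      have "\<forall>i\<in>I. \<forall>\<^sub>F e in at_right 0. a i \<bullet> (y + e *\<^sub>R k) \<le> b i"
      proof
        fix i assume "i \<in> I"
        show "\<forall>\<^sub>F e in at_right 0. a i \<bullet> (y + e *\<^sub>R k) \<le> b i"
        proof (cases "i \<in> J")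
          case True
          with k have "a i \<bullet> (y + e *\<^sub>R k) \<le> b i" if "e > 0" for e
            using that by (auto simp: J_def inner_add_right mult_le_0_iff)
          then show ?thesis
            by (simp add: eventually_at_filter)
        next
          case False
          with \<open>i \<in> I\<close> \<open>y \<in> S\<close> have "a i \<bullet> (y + 0 *\<^sub>R k) < b i"
            by (force simp: J_def S_def)
          moreover have "((\<lambda>e. a i \<bullet> (y + e *\<^sub>R k)) \<longlongrightarrow> a i \<bullet> (y + 0 *\<^sub>R k)) (at_right 0)"
            by (intro tendsto_intros)
          ultimately have "\<forall>\<^sub>F e in at_right 0. a i \<bullet> (y + e *\<^sub>R k) < b i"
            by (intro order_tendstoD(2))
          then show ?thesis
            by (rule eventually_mono) simp
        qed
      qed
      from eventually_ball_finite[OF assms this] eventually_at_right_less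
      have "\<forall>\<^sub>F e in at_right 0. (\<forall>i\<in>I. a i \<bullet> (y + e *\<^sub>R k) \<le> b i) \<and> 0 < (e::real)"
        by (rule eventually_conj)
      then obtain e :: real where "e > 0" "y + e *\<^sub>R k \<in> S"
        unfolding S_def by (auto dest!: eventually_happens'[rotated])
      then have "(x - y) \<bullet> (y + e *\<^sub>R k - y) \<le> 0"
        unfolding y_def using S by (intro closest_point_dot)
      then show ?thesis using \<open>e > 0\<close> by (simp add: mult_le_0_iff)
    qed
    moreover have "\<forall>j\<in>J. a j \<bullet> (x - y) \<le> r"
      using r by (auto simp: J_def inner_diff_right algebra_simps)
    ultimately have "norm (x - y) \<le> C * r"
      using C[of J] \<open>0 \<le> r\<close> unfolding P_def J_def by blast
    then show "\<exists>y. (\<forall>i\<in>I. a i \<bullet> y \<le> b i) \<and> norm (x - y) \<le> C * r"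
      using \<open>y \<in> S\<close> by (auto simp: S_def)
  qed
qed

text \<open>
  The uniformity of the Hoffman constant in the right-hand side keeps solutions of the relaxed
  systems in a fixed ball, so that compactness applies.
\<close>

lemma infeasible_gap:
  fixes a :: "'i \<Rightarrow> 'a::euclidean_space"
  assumes "finite I" and infeas: "\<nexists>x. \<forall>i\<in>I. a i \<bullet> x \<le> b i"
  shows "\<exists>\<delta>>0. \<forall>x. \<not> (\<forall>i\<in>I. a i \<bullet> x \<le> b i + \<delta>)"
proof (rule ccontr)
  assume "\<not> ?thesis"
  then have feas: "\<exists>x. \<forall>i\<in>I. a i \<bullet> x \<le> b i + \<delta>" if "\<delta> > 0" for \<delta> using that by blast
  obtain C where C: "C \<ge> 0"
    "\<And>b x r. \<exists>y. \<forall>i\<in>I. a i \<bullet> y \<le> b i \<Longrightarrow> 0 \<le> r \<Longrightarrow> \<forall>i\<in>I. a i \<bullet> x \<le> b i + r \<Longrightarrow>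
      \<exists>y. (\<forall>i\<in>I. a i \<bullet> y \<le> b i) \<and> norm (x - y) \<le> C * r"
    using Hoffman[OF \<open>finite I\<close>, of a] by blast
  define R where "R = (\<Sum>i\<in>I. \<bar>b i\<bar>)"
  have R: "R \<ge> 0" "\<bar>b i\<bar> \<le> R" if "i \<in> I" for i
    using that \<open>finite I\<close> by (auto simp: R_def intro: member_le_sum sum_nonneg)
  \<comment> \<open>Hoffman's bound is applied at the origin, which violates every relaxed system by
    at most \<open>R\<close>.\<close>
  have "\<exists>y. (\<forall>i\<in>I. a i \<bullet> y \<le> b i + 1 / Suc n) \<and> norm y \<le> C * R" for n
  proof -
    have "\<forall>i\<in>I. a i \<bullet> 0 \<le> (b i + 1 / Suc n) + R"
    proof
      fix i assume "i \<in> I"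
      then have "\<bar>b i\<bar> \<le> R" by (rule R)
      moreover have "0 \<le> 1 / real (Suc n)" by simp
      ultimately show "a i \<bullet> 0 \<le> (b i + 1 / Suc n) + R" unfolding inner_zero_right by linarith
    qed
    from C(2)[OF feas _ this] show ?thesis
      by (auto simp: R_def sum_nonneg)
  qed
  then obtain y where y: "\<And>n i. i \<in> I \<Longrightarrow> a i \<bullet> y n \<le> b i + 1 / Suc n" "\<And>n. norm (y n) \<le> C * R"
    by metis
  have "\<forall>n. y n \<in> cball 0 (C * R)" using y by simp
  then obtain l s where s: "strict_mono s" "(y \<circ> s) \<longlonglongrightarrow> l"
    using compact_cball[of "0::'a" "C * R"] unfolding compact_def by metis
  have "a i \<bullet> l \<le> b i" if "i \<in> I" for i
  proof (rule LIMSEQ_le)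
    show "(\<lambda>n. a i \<bullet> (y \<circ> s) n) \<longlonglongrightarrow> a i \<bullet> l"
      by (intro tendsto_intros s)
    have "((\<lambda>n. b i + 1 / real (Suc n)) \<circ> s) \<longlonglongrightarrow> b i + 0"
      by (intro LIMSEQ_subseq_LIMSEQ s tendsto_add tendsto_const LIMSEQ_Suc lim_1_over_n)
    then show "(\<lambda>n. b i + 1 / real (Suc (s n))) \<longlonglongrightarrow> b i" by (simp add: o_def)
    show "\<exists>N. \<forall>n\<ge>N. a i \<bullet> (y \<circ> s) n \<le> b i + 1 / real (Suc (s n))"
      using y that by auto
  qed
  with infeas show False by blast
qed

subsection \<open>Polyhedral residuals\<close>

text \<open>A pair is a half-space given by normal and offset. The normal may be zero, so that
  constant components of affine maps can be listed as rows too.\<close>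

definition solutions :: "('a::real_inner \<times> real) set \<Rightarrow> 'a set" where
  "solutions H = {x. \<forall>h\<in>H. fst h \<bullet> x \<le> snd h}"

text \<open>This is the recession cone of \<open>solutions H\<close> when that set is nonempty; it
  contains \<open>0\<close> even for an infeasible system.\<close>

definition recession_dirs :: "('a::real_inner \<times> real) set \<Rightarrow> 'a set" where
  "recession_dirs H = {z. \<forall>h\<in>H. fst h \<bullet> z \<le> 0}"

lemma solutions_Un: "solutions (H \<union> A) = solutions H \<inter> solutions A"
  by (auto simp: solutions_def)

lemma recession_dirs_Un: "recession_dirs (H \<union> A) = recession_dirs H \<inter> recession_dirs A"
  by (auto simp: recession_dirs_def)

lemma closed_solutions: "closed (solutions (S :: ('a::euclidean_space \<times> real) set))"
  unfolding solutions_def by (rule closed_convex_halfspaces)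

lemma solutions_add_recession:
  assumes "x \<in> solutions H" "z \<in> recession_dirs H" "0 \<le> t"
  shows "x + t *\<^sub>R z \<in> solutions H"
  unfolding solutions_def
proof (intro CollectI ballI)
  fix h assume "h \<in> H"
  then have "fst h \<bullet> x \<le> snd h" "t * (fst h \<bullet> z) \<le> 0"
    using assms by (auto simp: solutions_def recession_dirs_def mult_le_0_iff)
  then show "fst h \<bullet> (x + t *\<^sub>R z) \<le> snd h" by (simp add: inner_add_right)
qed

lemma polyhedron_eq_solutions:
  fixes S :: "'a::euclidean_space set"
  assumes "polyhedron S"
  obtains H where "finite H" "S = solutions H"
proof -
  obtain \<F> where \<F>: "finite \<F>" "S = \<Inter>\<F>"
    "\<forall>h\<in>\<F>. \<exists>a b. a \<noteq> 0 \<and> h = {x::'a. a \<bullet> x \<le> b}"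
    using assms unfolding polyhedron_def by blast
  have "\<forall>h\<in>\<F>. \<exists>p. h = {x. fst p \<bullet> x \<le> snd p}"
    using \<F>(3) by (metis fst_conv snd_conv)
  then obtain f where f: "\<And>h. h \<in> \<F> \<Longrightarrow> h = {x. fst (f h) \<bullet> x \<le> snd (f h)}"
    by metis
  have "S = solutions (f ` \<F>)"
    unfolding \<F>(2) solutions_def using f by blast
  with \<F>(1) show thesis by (intro that) auto
qed

lemma exists_near_infdist:
  fixes S :: "'a::metric_space set"
  assumes "S \<noteq> {}"
  shows "\<exists>w\<in>S. dist x w < infdist x S + 1"
proof -
  have "(INF w\<in>S. dist x w) < infdist x S + 1"
    using assms by (simp add: infdist_notempty)
  then show ?thesis
    using assms by (subst (asm) cINF_less_iff) auto
qed

text \<open>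
  Each \<open>(H, A) \<in> Q\<close> describes a piece \<open>solutions H\<close> on which \<open>\<phi>\<close> is comparable to the maximal
  violation of the inequalities \<open>fst h \<bullet> x \<le> snd h\<close>, \<open>h \<in> A\<close>; comparability, rather than
  equality, lets the norm in the definition of \<open>\<phi>\<close> be arbitrary.
\<close>

locale polyhedral_residual =
  fixes \<phi> :: "'a::euclidean_space \<Rightarrow> real" and \<Omega> :: "'a set"
    and Q :: "(('a \<times> real) set \<times> ('a \<times> real) set) set" and K L :: real
  assumes finite_Q: "finite Q"
    and finite_rows: "(H, A) \<in> Q \<Longrightarrow> finite H \<and> finite A"
    and cover: "\<exists>(H, A)\<in>Q. x \<in> solutions H"
    and K_pos: "K > 0"
    and row_le: "(H, A) \<in> Q \<Longrightarrow> x \<in> solutions H \<Longrightarrow> h \<in> A \<Longrightarrow> fst h \<bullet> x \<le> snd h + K * \<phi> x"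
    and phi_le: "(H, A) \<in> Q \<Longrightarrow> x \<in> solutions H \<Longrightarrow> 0 \<le> r \<Longrightarrow>
      \<forall>h\<in>A. fst h \<bullet> x \<le> snd h + r \<Longrightarrow> \<phi> x \<le> K * r"
    and L_nonneg: "L \<ge> 0"
    and phi_Lipschitz: "\<phi> x \<le> \<phi> y + L * norm (x - y)"
    and ray_limit: "\<exists>l. ((\<lambda>t. \<phi> (t *\<^sub>R x) / t) \<longlongrightarrow> l) at_top"
    and phi_nonneg: "\<phi> x \<ge> 0"
    and Omega_eq: "\<Omega> = {x. \<phi> x = 0}"
    and Omega_nonempty: "\<Omega> \<noteq> {}"
begin

lemma Omega_piece:
  assumes "(H, A) \<in> Q"
  shows "\<Omega> \<inter> solutions H = solutions (H \<union> A)"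
proof (intro equalityI subsetI)
  fix x assume x: "x \<in> \<Omega> \<inter> solutions H"
  then have "\<forall>h\<in>A. fst h \<bullet> x \<le> snd h"
    using row_le[OF assms, of x] by (auto simp: Omega_eq)
  with x show "x \<in> solutions (H \<union> A)"
    by (auto simp: solutions_def)
next
  fix x assume "x \<in> solutions (H \<union> A)"
  then have x: "x \<in> solutions H" "\<forall>h\<in>A. fst h \<bullet> x \<le> snd h + 0"
    by (auto simp: solutions_def)
  then have "\<phi> x \<le> K * 0" using phi_le[OF assms, of x 0] by simp
  with x show "x \<in> \<Omega> \<inter> solutions H" using phi_nonneg[of x] by (simp add: Omega_eq)
qed

text \<open>A piece that meets \<open>\<Omega>\<close> gives the second alternative at all of its
  points, a piece that misses it gives the first. Stated with a common \<open>c\<close>, the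
  disjunction persists when \<open>c\<close> shrinks, so a minimum over the finitely many pieces can
  be taken.\<close>

lemma local_error_bound: "\<exists>c>0. \<forall>x. c \<le> \<phi> x \<or> c * infdist x \<Omega> \<le> \<phi> x"
proof -
  define P where "P q c \<longleftrightarrow> (\<forall>x\<in>solutions (fst q). c \<le> \<phi> x \<or> c * infdist x \<Omega> \<le> \<phi> x)"
    for q :: "('a \<times> real) set \<times> ('a \<times> real) set" and c
  have "\<exists>c>0. \<forall>q\<in>Q. P q c"
  proof (rule finite_uniform_pos[OF finite_Q])
    show "P q c'" if "P q c" "0 < c'" "c' \<le> c" for q c c'
      unfolding P_def
    proof
      fix x assume "x \<in> solutions (fst q)"
      moreover have "c' * infdist x \<Omega> \<le> c * infdist x \<Omega>"
        using that by (intro mult_right_mono infdist_nonneg)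
      ultimately show "c' \<le> \<phi> x \<or> c' * infdist x \<Omega> \<le> \<phi> x"
        using that unfolding P_def by fastforce
    qed
    show "\<exists>c>0. P q c" if "q \<in> Q" for q
    proof (cases q)
      case (Pair H A)
      with that have q: "(H, A) \<in> Q" by simp
      then have fin: "finite (H \<union> A)" using finite_rows by blast
      have viol: "\<forall>h\<in>H \<union> A. fst h \<bullet> x \<le> snd h + r"
        if "x \<in> solutions H" "K * \<phi> x \<le> r" for x r
      proof
        fix h assume "h \<in> H \<union> A"
        then show "fst h \<bullet> x \<le> snd h + r"
        proof
          assume "h \<in> H"
          with that(1) have "fst h \<bullet> x \<le> snd h" by (simp add: solutions_def)
          moreover have "0 \<le> K * \<phi> x" using K_pos phi_nonneg by simp
          ultimately show ?thesis using that(2) by linarith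
        next
          assume "h \<in> A"
          then show ?thesis using row_le[OF q that(1), of h] that(2) by linarith
        qed
      qed
      show ?thesis
      proof (cases "solutions (H \<union> A) = {}")
        case True
        then have "\<nexists>x. \<forall>h\<in>H \<union> A. fst h \<bullet> x \<le> snd h" by (auto simp: solutions_def)
        from infeasible_gap[OF fin this]
        obtain \<delta> where \<delta>: "\<delta> > 0" "\<And>x. \<not> (\<forall>h\<in>H \<union> A. fst h \<bullet> x \<le> snd h + \<delta>)" by blast
        have "\<delta> / K \<le> \<phi> x" if "x \<in> solutions H" for x
        proof (rule ccontr)
          assume "\<not> \<delta> / K \<le> \<phi> x"
          then have "K * \<phi> x \<le> \<delta>" using K_pos by (simp add: field_simps)
          with viol[OF that] \<delta>(2) show False by blast
        qed
        then show ?thesis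
          using \<open>\<delta> > 0\<close> K_pos Pair by (intro exI[of _ "\<delta> / K"]) (auto simp: P_def)
      next
        case False
        then have feas: "\<exists>y. \<forall>h\<in>H \<union> A. fst h \<bullet> y \<le> snd h" by (auto simp: solutions_def)
        obtain C where C: "C \<ge> 0"
          "\<And>b x r. \<exists>y. \<forall>i\<in>H \<union> A. fst i \<bullet> y \<le> b i \<Longrightarrow> 0 \<le> r \<Longrightarrow>
            \<forall>i\<in>H \<union> A. fst i \<bullet> x \<le> b i + r \<Longrightarrow>
            \<exists>y. (\<forall>i\<in>H \<union> A. fst i \<bullet> y \<le> b i) \<and> norm (x - y) \<le> C * r"
          using Hoffman[OF fin, of fst] by blast
        \<comment> \<open>The summand 1 keeps the denominator positive when
          \<open>C = 0\<close>.\<close>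
        have "1 / (C * K + 1) * infdist x \<Omega> \<le> \<phi> x" if "x \<in> solutions H" for x
        proof -
          have "0 \<le> K * \<phi> x" using K_pos phi_nonneg by simp
          from C(2)[OF feas this viol[OF that order_refl]]
          obtain y where "y \<in> solutions (H \<union> A)" "norm (x - y) \<le> C * (K * \<phi> x)"
            by (auto simp: solutions_def)
          then have "infdist x \<Omega> \<le> C * (K * \<phi> x)"
            using infdist_le[of y \<Omega> x] Omega_piece[OF q] unfolding dist_norm by fastforce
          also have "\<dots> \<le> (C * K + 1) * \<phi> x"
            using phi_nonneg[of x] by (simp add: algebra_simps)
          finally show ?thesis using C(1) K_pos by (simp add: field_simps add_pos_nonneg)
        qed
        moreover have "1 / (C * K + 1) > 0" using C(1) K_pos by (simp add: add_nonneg_pos)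
        ultimately show ?thesis
          using Pair by (intro exI[of _ "1 / (C * K + 1)"]) (simp add: P_def)
      qed
    qed
  qed
  then obtain c where "c > 0" "\<And>q. q \<in> Q \<Longrightarrow> P q c" by blast
  moreover have "\<exists>q\<in>Q. x \<in> solutions (fst q)" for x using cover[of x] by (simp add: case_prod_unfold)
  ultimately show ?thesis unfolding P_def by metis
qed

section \<open>Asymptotic directions and the recession cone of \<open>\<Omega>\<close>\<close>

text \<open>A point \<open>w n\<close> of \<open>\<Omega>\<close> nearest to \<open>x n\<close> up
  to 1 has the same limit after division by \<open>t n\<close>, which also removes the slack 1. One
  piece contains \<open>w n\<close> for infinitely many \<open>n\<close>, and dividing its
  inequalities by \<open>t n\<close> makes the right-hand sides vanish.\<close>

lemma asymptotic_direction:
  assumes t: "filterlim t at_top sequentially"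
    and x: "(\<lambda>n. x n /\<^sub>R t n) \<longlonglongrightarrow> z"
    and d: "(\<lambda>n. infdist (x n) \<Omega> / t n) \<longlonglongrightarrow> 0"
  shows "\<exists>(H, A)\<in>Q. solutions (H \<union> A) \<noteq> {} \<and> z \<in> recession_dirs (H \<union> A)"
proof -
  have "\<forall>n. \<exists>w. w \<in> \<Omega> \<and> dist (x n) w < infdist (x n) \<Omega> + 1"
    using exists_near_infdist[OF Omega_nonempty] by blast
  from choice[OF this] obtain w where
    w: "\<And>n. w n \<in> \<Omega>" "\<And>n. dist (x n) (w n) < infdist (x n) \<Omega> + 1" by blast
  have t_pos: "\<forall>\<^sub>F n in sequentially. t n > 0"
    using t by (simp add: filterlim_at_top_dense)
  have t_inv: "(\<lambda>n. c / t n) \<longlonglongrightarrow> 0" for c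
    by (rule real_tendsto_divide_at_top[OF tendsto_const t])
  have "(\<lambda>n. (x n - w n) /\<^sub>R t n) \<longlonglongrightarrow> 0"
  proof (rule Lim_null_comparison)
    show "(\<lambda>n. infdist (x n) \<Omega> / t n + 1 / t n) \<longlonglongrightarrow> 0"
      using tendsto_add[OF d t_inv[of 1]] by simp
    show "\<forall>\<^sub>F n in sequentially. norm ((x n - w n) /\<^sub>R t n) \<le> infdist (x n) \<Omega> / t n + 1 / t n"
      using t_pos
    proof eventually_elim
      case (elim n)
      then have "norm (x n - w n) / t n \<le> (infdist (x n) \<Omega> + 1) / t n"
        using w(2)[of n] by (intro divide_right_mono) (auto simp: dist_norm)
      moreover have "norm ((x n - w n) /\<^sub>R t n) = norm (x n - w n) / t n"
        using elim by (simp only: norm_scaleR) (simp add: divide_inverse mult.commute)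
      ultimately show ?case by (simp add: add_divide_distrib)
    qed
  qed
  from tendsto_diff[OF x this] have wz: "(\<lambda>n. w n /\<^sub>R t n) \<longlonglongrightarrow> z"
    by (simp add: algebra_simps)
  have "\<exists>q\<in>Q. w n \<in> solutions (fst q \<union> snd q)" for n
  proof -
    obtain H A where q: "(H, A) \<in> Q" "w n \<in> solutions H" using cover[of "w n"] by blast
    with w(1)[of n] Omega_piece[OF q(1)] show ?thesis by (intro bexI[of _ "(H, A)"]) auto
  qed
  then have "\<exists>\<^sub>F n in sequentially. \<exists>q\<in>Q. w n \<in> solutions (fst q \<union> snd q)" by simp
  from frequently_bex_finite[OF finite_Q this]
  obtain q where q: "q \<in> Q" "\<exists>\<^sub>F n in sequentially. w n \<in> solutions (fst q \<union> snd q)" by blast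
  \<comment> \<open>Instead of extracting a subsequence: a positive limit would exclude
    \<open>w n\<close> from the piece eventually, contradicting that it lies there
    frequently.\<close>
  have "fst h \<bullet> z \<le> 0" if h: "h \<in> fst q \<union> snd q" for h
  proof (rule ccontr)
    assume "\<not> fst h \<bullet> z \<le> 0"
    moreover have "(\<lambda>n. fst h \<bullet> (w n /\<^sub>R t n) - snd h / t n) \<longlonglongrightarrow> fst h \<bullet> z - 0"
      by (intro tendsto_intros wz t_inv)
    ultimately have "\<forall>\<^sub>F n in sequentially. fst h \<bullet> (w n /\<^sub>R t n) - snd h / t n > 0"
      by (intro order_tendstoD(1)) auto
    with t_pos have "\<forall>\<^sub>F n in sequentially. w n \<notin> solutions (fst q \<union> snd q)"
    proof eventually_elim
      case (elim n)
      then have "fst h \<bullet> w n > snd h" by (simp add: field_simps)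
      with h show ?case by (auto simp: solutions_def not_le)
    qed
    with q(2) show False by (simp add: frequently_def)
  qed
  moreover have "solutions (fst q \<union> snd q) \<noteq> {}"
    using frequently_ex[OF q(2)] by blast
  ultimately show ?thesis
    using q(1) by (intro bexI[of _ q]) (auto simp: recession_dirs_def case_prod_unfold)
qed

text \<open>A ray in the possibly nonconvex \<open>\<Omega>\<close> may cross several pieces. Its
  points \<open>x + real n *\<^sub>R z\<close> have distance 0 from \<open>\<Omega>\<close> and tend
  to \<open>z\<close> after division by \<open>n\<close>, so \<open>asymptotic_direction\<close>
  provides a single piece. Conversely, a ray needs a starting point, hence the nonemptiness.\<close>

lemma recession_cone_Omega:
  "recession_cone \<Omega> =
    {z. \<exists>(H, A)\<in>Q. solutions (H \<union> A) \<noteq> {} \<and> z \<in> recession_dirs (H \<union> A)}"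
proof (intro equalityI subsetI CollectI)
  fix z assume "z \<in> recession_cone \<Omega>"
  then obtain x where x: "\<And>t. t \<ge> 0 \<Longrightarrow> x + t *\<^sub>R z \<in> \<Omega>"
    by (auto simp: recession_cone_def)
  have lim: "(\<lambda>n. inverse (real n)) \<longlonglongrightarrow> 0" by (rule lim_inverse_n)
  have "(\<lambda>n. inverse (real n) *\<^sub>R x + z) \<longlonglongrightarrow> 0 *\<^sub>R x + z"
    by (intro tendsto_intros lim)
  then have "(\<lambda>n. inverse (real n) *\<^sub>R x + z) \<longlonglongrightarrow> z" by simp
  moreover have "\<forall>\<^sub>F n in sequentially.
      inverse (real n) *\<^sub>R x + z = (x + real n *\<^sub>R z) /\<^sub>R real n"
    using eventually_gt_at_top[of 0] by eventually_elim (simp add: scaleR_add_right)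
  ultimately have "(\<lambda>n. (x + real n *\<^sub>R z) /\<^sub>R real n) \<longlonglongrightarrow> z"
    by (rule Lim_transform_eventually)
  moreover have "infdist (x + real n *\<^sub>R z) \<Omega> = 0" for n
    using x[of "real n"] by simp
  ultimately show "\<exists>(H, A)\<in>Q. solutions (H \<union> A) \<noteq> {} \<and> z \<in> recession_dirs (H \<union> A)"
    by (intro asymptotic_direction[OF filterlim_real_sequentially]) auto
next
  fix z assume "z \<in> {z. \<exists>(H, A)\<in>Q. solutions (H \<union> A) \<noteq> {} \<and> z \<in> recession_dirs (H \<union> A)}"
  then obtain H A x where q: "(H, A) \<in> Q" and x: "x \<in> solutions (H \<union> A)"
    and z: "z \<in> recession_dirs (H \<union> A)" by auto
  have "x + t *\<^sub>R z \<in> \<Omega>" if "t \<ge> 0" for t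
    using Omega_piece[OF q] solutions_add_recession[OF x z that] by blast
  moreover from this[of 0] have "x \<in> \<Omega>" by simp
  ultimately show "z \<in> recession_cone \<Omega>" unfolding recession_cone_def by blast
qed

text \<open>For a fixed solution \<open>p\<close> of the piece, \<open>p + z\<close> lies in
  \<open>\<Omega>\<close> at distance \<open>norm p\<close> from \<open>z\<close>, however long
  \<open>z\<close> is.\<close>

lemma infdist_recession_cone: "\<exists>M\<ge>0. \<forall>z\<in>recession_cone \<Omega>. infdist z \<Omega> \<le> M"
proof -
  have "\<exists>M\<ge>0. \<forall>q\<in>Q. \<forall>z\<in>recession_dirs (fst q \<union> snd q).
      solutions (fst q \<union> snd q) \<noteq> {} \<longrightarrow> infdist z \<Omega> \<le> M"
  proof (rule finite_uniform_bound[OF finite_Q])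
    fix q assume "q \<in> Q"
    show "\<exists>M. \<forall>z\<in>recession_dirs (fst q \<union> snd q).
      solutions (fst q \<union> snd q) \<noteq> {} \<longrightarrow> infdist z \<Omega> \<le> M"
    proof (cases "solutions (fst q \<union> snd q) = {}")
      case False
      then obtain p where p: "p \<in> solutions (fst q \<union> snd q)" by blast
      have "infdist z \<Omega> \<le> norm p" if "z \<in> recession_dirs (fst q \<union> snd q)" for z
      proof -
        have "p + 1 *\<^sub>R z \<in> solutions (fst q \<union> snd q)"
          using p that by (intro solutions_add_recession) auto
        then have "p + z \<in> \<Omega>"
          using Omega_piece[of "fst q" "snd q"] \<open>q \<in> Q\<close> by auto
        from infdist_le[OF this, of z] show ?thesis by (simp add: dist_norm)
      qed
      then show ?thesis by blast
    qed auto
  qed fastforce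
  then show ?thesis unfolding recession_cone_Omega by fastforce
qed

lemma recession_fun_tendsto: "((\<lambda>t. \<phi> (t *\<^sub>R z) / t) \<longlongrightarrow> recession_fun \<phi> z) at_top"
proof -
  obtain l where "((\<lambda>t. \<phi> (t *\<^sub>R z) / t) \<longlongrightarrow> l) at_top" using ray_limit by blast
  moreover from this have "recession_fun \<phi> z = l"
    unfolding recession_fun_def by (intro tendsto_Lim) auto
  ultimately show ?thesis by simp
qed

text \<open>Shifting the ray to the origin costs at most \<open>L * norm p\<close>, which vanishes
  after division by \<open>t\<close>.\<close>

lemma recession_fun_nonpos:
  assumes "\<And>t. t \<ge> 0 \<Longrightarrow> \<phi> (p + t *\<^sub>R z) \<le> B"
  shows "recession_fun \<phi> z \<le> 0"
proof (rule tendsto_le[OF _ _ recession_fun_tendsto])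
  show "((\<lambda>t. (B + L * norm p) / t) \<longlongrightarrow> 0) at_top"
    by (rule real_tendsto_divide_at_top[OF tendsto_const filterlim_ident])
  show "\<forall>\<^sub>F t in at_top. \<phi> (t *\<^sub>R z) / t \<le> (B + L * norm p) / t"
    using eventually_gt_at_top[of 0]
  proof eventually_elim
    case (elim t)
    then have "\<phi> (t *\<^sub>R z) \<le> B + L * norm p"
      using phi_Lipschitz[of "t *\<^sub>R z" "p + t *\<^sub>R z"] assms[of t] by simp
    with elim show ?case by (simp add: divide_right_mono)
  qed
qed auto

section \<open>Sufficient conditions: growth, homogeneity, coercivity, recession inclusion\<close>

text \<open>Far out, the distance to \<open>\<Omega>\<close> is at most a multiple of
  \<open>norm x\<close> and the growth decides. Inside a ball the distance is bounded, so even the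
  alternative \<open>c' \<le> \<phi> x\<close> of the local bound controls it.\<close>

lemma error_bound_linear_growth:
  assumes "c > 0" and growth: "\<And>x. x \<in> V \<Longrightarrow> R \<le> norm x \<Longrightarrow> c * norm x \<le> \<phi> x"
  shows "\<exists>\<tau>>0. \<forall>x\<in>V. \<tau> * infdist x \<Omega> \<le> \<phi> x"
proof -
  obtain p where p: "p \<in> \<Omega>" using Omega_nonempty by blast
  obtain c' where c': "c' > 0" "\<And>x. c' \<le> \<phi> x \<or> c' * infdist x \<Omega> \<le> \<phi> x"
    using local_error_bound by blast
  \<comment> \<open>Radius at least 1 allows \<open>norm p \<le> norm p * norm x\<close> in the far
    case, which makes the distance estimate linear in \<open>norm x\<close>.\<close>
  define R' where "R' = max R 1"
  have R': "R' \<ge> 1" "R' \<ge> R" by (auto simp: R'_def)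
  define \<tau> where "\<tau> = min (c / (1 + norm p)) (min c' (c' / (R' + norm p)))"
  have pos: "1 + norm p > 0" "R' + norm p > 0"
    using R' by (auto intro: add_pos_nonneg)
  have "\<tau> > 0" using \<open>c > 0\<close> c'(1) pos by (simp add: \<tau>_def)
  moreover have "\<tau> * infdist x \<Omega> \<le> \<phi> x" if "x \<in> V" for x
  proof -
    have d: "infdist x \<Omega> \<le> norm x + norm p"
      using infdist_le[OF p, of x] norm_triangle_ineq4[of x p] by (simp add: dist_norm)
    have dn: "0 \<le> infdist x \<Omega>" by (rule infdist_nonneg)
    have weaken: "\<tau> * infdist x \<Omega> \<le> \<phi> x" if "\<tau> \<le> k" "k * infdist x \<Omega> \<le> \<phi> x" for k
      using mult_right_mono[OF that(1) dn] that(2) by linarith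
    consider "R' \<le> norm x" | "norm x < R'" "c' \<le> \<phi> x" | "c' * infdist x \<Omega> \<le> \<phi> x"
      using c'(2)[of x] by linarith
    then show ?thesis
    proof cases
      case 1
      have "norm p * 1 \<le> norm p * norm x"
        using 1 R' by (intro mult_left_mono) auto
      with d have "infdist x \<Omega> \<le> (1 + norm p) * norm x" by (simp add: algebra_simps)
      then have "c / (1 + norm p) * infdist x \<Omega> \<le> c / (1 + norm p) * ((1 + norm p) * norm x)"
        using \<open>c > 0\<close> by (intro mult_left_mono) auto
      also have "\<dots> = c * norm x" using pos by simp
      also have "\<dots> \<le> \<phi> x" using growth[OF that] 1 R' by linarith
      finally show ?thesis by (rule weaken[rotated]) (simp add: \<tau>_def)
    next
      case 2
      have "c' / (R' + norm p) * infdist x \<Omega> \<le> c' / (R' + norm p) * (R' + norm p)"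
        using d 2 c'(1) pos by (intro mult_left_mono) auto
      also have "\<dots> = c'" using pos by simp
      also have "\<dots> \<le> \<phi> x" using 2 by simp
      finally show ?thesis by (rule weaken[rotated]) (simp add: \<tau>_def)
    next
      case 3
      then show ?thesis by (rule weaken[rotated]) (simp add: \<tau>_def)
    qed
  qed
  ultimately show ?thesis by blast
qed

text \<open>The zero set \<open>\<Omega>\<close> is invariant under positive scaling, so the
  distance scales like \<open>\<phi>\<close>, and each \<open>x\<close> can be moved to where the
  local bound is a distance bound.\<close>

lemma error_bound_homogeneous:
  assumes hom: "\<And>x c. c > 0 \<Longrightarrow> \<phi> (c *\<^sub>R x) = c * \<phi> x"
  shows "\<exists>\<tau>>0. \<forall>x. \<tau> * infdist x \<Omega> \<le> \<phi> x"
proof -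
  obtain c where c: "c > 0" "\<And>x. c \<le> \<phi> x \<or> c * infdist x \<Omega> \<le> \<phi> x"
    using local_error_bound by blast
  have "c * infdist x \<Omega> \<le> \<phi> x" for x
  proof (cases "\<phi> x = 0")
    case True
    then have "x \<in> \<Omega>" by (simp add: Omega_eq)
    with True show ?thesis by simp
  next
    case False
    with phi_nonneg[of x] have "\<phi> x > 0" by simp
    \<comment> \<open>Chosen so that \<open>\<phi> (t *\<^sub>R x) = c / 2 < c\<close>, which rules
      out the first alternative of the local bound.\<close>
    define t where "t = c / (2 * \<phi> x)"
    have "t > 0" using \<open>\<phi> x > 0\<close> c(1) by (simp add: t_def)
    have "\<phi> (t *\<^sub>R x) = c / 2" using \<open>\<phi> x > 0\<close> hom[OF \<open>t > 0\<close>] by (simp add: t_def)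
    with c have le: "c * infdist (t *\<^sub>R x) \<Omega> \<le> t * \<phi> x"
      using c(2)[of "t *\<^sub>R x"] hom[OF \<open>t > 0\<close>, of x] by auto
    have "t * infdist x \<Omega> \<le> (INF y\<in>\<Omega>. dist (t *\<^sub>R x) y)"
    proof (rule cINF_greatest[OF Omega_nonempty])
      fix y assume "y \<in> \<Omega>"
      then have "y /\<^sub>R t \<in> \<Omega>"
        using hom[of "inverse t" y] \<open>t > 0\<close> by (simp add: Omega_eq)
      from infdist_le[OF this, of x] have "t * infdist x \<Omega> \<le> t * dist x (y /\<^sub>R t)"
        using \<open>t > 0\<close> by simp
      also have "\<dots> = norm (t *\<^sub>R (x - y /\<^sub>R t))" using \<open>t > 0\<close> by (simp add: dist_norm)
      also have "\<dots> = dist (t *\<^sub>R x) y" using \<open>t > 0\<close> by (simp add: dist_norm algebra_simps)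
      finally show "t * infdist x \<Omega> \<le> dist (t *\<^sub>R x) y" .
    qed
    also have "\<dots> = infdist (t *\<^sub>R x) \<Omega>" using Omega_nonempty by (simp add: infdist_notempty)
    finally have "c * (t * infdist x \<Omega>) \<le> c * infdist (t *\<^sub>R x) \<Omega>"
      using c(1) by (intro mult_left_mono) auto
    with le have "t * (c * infdist x \<Omega>) \<le> t * \<phi> x" by (simp add: algebra_simps)
    then show ?thesis using \<open>t > 0\<close> by simp
  qed
  with c(1) show ?thesis by blast
qed

text \<open>The point \<open>t *\<^sub>R x\<close> may leave the piece of \<open>x\<close>. But
  \<open>x\<close> is boundedly close to a recession direction \<open>k\<close> of its piece, and
  for a fixed \<open>p\<close> in the piece the point \<open>p + t *\<^sub>R k\<close> stays there,
  boundedly close to \<open>t *\<^sub>R x\<close>. One factor \<open>K\<close> comes from passing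
  from \<open>\<phi>\<close> to the rows, the other from passing back.\<close>

lemma scaling_bound:
  "\<exists>M\<ge>0. \<forall>x t. 0 \<le> t \<longrightarrow> t \<le> 1 \<longrightarrow> \<phi> (t *\<^sub>R x) \<le> K\<^sup>2 * t * \<phi> x + M"
proof -
  have "\<exists>M\<ge>0. \<forall>q\<in>Q. \<forall>x\<in>solutions (fst q). \<forall>t. 0 \<le> t \<longrightarrow> t \<le> 1 \<longrightarrow>
      \<phi> (t *\<^sub>R x) \<le> K\<^sup>2 * t * \<phi> x + M"
  proof (rule finite_uniform_bound[OF finite_Q])
    fix q assume "q \<in> Q"
    show "\<exists>M. \<forall>x\<in>solutions (fst q). \<forall>t. 0 \<le> t \<longrightarrow> t \<le> 1 \<longrightarrow>
      \<phi> (t *\<^sub>R x) \<le> K\<^sup>2 * t * \<phi> x + M"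
    proof (cases "solutions (fst q) = {}")
      case True
      then show ?thesis by simp
    next
      case False
      then obtain p where p: "p \<in> solutions (fst q)" by blast
      obtain H A where [simp]: "q = (H, A)" by (cases q)
      have q: "(H, A) \<in> Q" using \<open>q \<in> Q\<close> by simp
      then have fin: "finite H" "finite A" using finite_rows by blast+
      obtain C where C: "C \<ge> 0"
        "\<And>b x r. \<exists>y. \<forall>i\<in>H. fst i \<bullet> y \<le> b i \<Longrightarrow> 0 \<le> r \<Longrightarrow> \<forall>i\<in>H. fst i \<bullet> x \<le> b i + r \<Longrightarrow>
          \<exists>y. (\<forall>i\<in>H. fst i \<bullet> y \<le> b i) \<and> norm (x - y) \<le> C * r"
        using Hoffman[OF fin(1), of fst] by blast
      define R where "R = (\<Sum>h\<in>H. \<bar>snd h\<bar>)"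
      have "R \<ge> 0" by (simp add: R_def sum_nonneg)
      have R: "snd h \<le> R" if "h \<in> H" for h
        using member_le_sum[of h H "\<lambda>h. \<bar>snd h\<bar>"] fin that by (simp add: R_def)
      \<comment> \<open>All contributions independent of \<open>x\<close> and \<open>t\<close>. The
        offset counts twice: once in bounding the row at \<open>k\<close>, once because
        \<open>snd h\<close> may be negative on the right of the row inequality at
        \<open>u\<close>.\<close>
      define E where "E = (\<Sum>h\<in>A. \<bar>fst h \<bullet> p\<bar> + 2 * \<bar>snd h\<bar> + norm (fst h) * (C * R))"
      have E: "\<bar>fst h \<bullet> p\<bar> + 2 * \<bar>snd h\<bar> + norm (fst h) * (C * R) \<le> E" if "h \<in> A" for h
        using member_le_sum[of h A "\<lambda>h. \<bar>fst h \<bullet> p\<bar> + 2 * \<bar>snd h\<bar> + norm (fst h) * (C * R)"]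
          fin that C(1) \<open>R \<ge> 0\<close> by (simp add: E_def)
      have "E \<ge> 0" unfolding E_def using C(1) \<open>R \<ge> 0\<close> by (intro sum_nonneg) auto
      have "\<phi> (t *\<^sub>R x) \<le> K\<^sup>2 * t * \<phi> x + (K * E + L * (C * R + norm p))"
        if x: "x \<in> solutions H" and t: "0 \<le> t" "t \<le> 1" for x t
      proof -
        have "\<exists>y::'a. \<forall>h\<in>H. fst h \<bullet> y \<le> 0" by (rule exI[of _ 0]) simp
        moreover have "\<forall>h\<in>H. fst h \<bullet> x \<le> 0 + R"
          using x R by (force simp: solutions_def)
        ultimately obtain k where k: "k \<in> recession_dirs H" "norm (x - k) \<le> C * R"
          using C(2)[of "\<lambda>_. 0" R x] \<open>R \<ge> 0\<close> by (auto simp: recession_dirs_def)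
        define u where "u = p + t *\<^sub>R k"
        have u: "u \<in> solutions H"
          unfolding u_def using p k t by (intro solutions_add_recession) auto
        have "\<forall>h\<in>A. fst h \<bullet> u \<le> snd h + (t * (K * \<phi> x) + E)"
        proof
          fix h assume h: "h \<in> A"
          have "fst h \<bullet> (k - x) \<le> norm (fst h) * norm (k - x)" by (rule norm_cauchy_schwarz)
          also have "\<dots> \<le> norm (fst h) * (C * R)"
            using k(2) by (intro mult_left_mono) (auto simp: norm_minus_commute)
          finally have "fst h \<bullet> k \<le> \<bar>snd h\<bar> + K * \<phi> x + norm (fst h) * (C * R)"
            using row_le[OF q x h] by (simp add: inner_diff_right)
          then have "t * (fst h \<bullet> k) \<le> t * (\<bar>snd h\<bar> + K * \<phi> x + norm (fst h) * (C * R))"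
            using t by (intro mult_left_mono)
          moreover have "t * (\<bar>snd h\<bar> + norm (fst h) * (C * R)) \<le> 1 * (\<bar>snd h\<bar> + norm (fst h) * (C * R))"
            using t C(1) \<open>R \<ge> 0\<close> by (intro mult_right_mono) auto
          ultimately have "t * (fst h \<bullet> k) \<le> t * (K * \<phi> x) + \<bar>snd h\<bar> + norm (fst h) * (C * R)"
            by (simp add: algebra_simps)
          then show "fst h \<bullet> u \<le> snd h + (t * (K * \<phi> x) + E)"
            using E[OF h] by (simp add: u_def inner_add_right)
        qed
        then have "\<phi> u \<le> K * (t * (K * \<phi> x) + E)"
          using t K_pos phi_nonneg[of x] \<open>E \<ge> 0\<close> by (intro phi_le[OF q u]) auto
        moreover have "norm (t *\<^sub>R x - u) \<le> C * R + norm p"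
        proof -
          have "t *\<^sub>R x - u = t *\<^sub>R (x - k) - p" by (simp add: u_def algebra_simps)
          then have "norm (t *\<^sub>R x - u) \<le> t * norm (x - k) + norm p"
            using norm_triangle_ineq4[of "t *\<^sub>R (x - k)" p] t by simp
          also have "t * norm (x - k) \<le> 1 * norm (x - k)"
            using t by (intro mult_right_mono) auto
          finally show ?thesis using k(2) by simp
        qed
        then have "L * norm (t *\<^sub>R x - u) \<le> L * (C * R + norm p)"
          using L_nonneg by (intro mult_left_mono)
        ultimately have "\<phi> (t *\<^sub>R x) \<le> K * (t * (K * \<phi> x) + E) + L * (C * R + norm p)"
          using phi_Lipschitz[of "t *\<^sub>R x" u] by linarith
        then show ?thesis by (simp add: algebra_simps power2_eq_square)
      qed
      then show ?thesis by auto
    qed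
  qed (meson add_left_mono order_trans)
  moreover have "\<exists>q\<in>Q. x \<in> solutions (fst q)" for x using cover[of x] by (simp add: case_prod_unfold)
  ultimately show ?thesis by metis
qed

text \<open>A far point \<open>x\<close> of the cone is shrunk to the sphere of radius
  \<open>R'\<close>, where coercivity makes \<open>\<phi>\<close> at least \<open>M + 1\<close>.
  This exceeds the additive loss \<open>M\<close> of \<open>scaling_bound\<close> by 1, leaving
  \<open>1 \<le> K\<^sup>2 * t * \<phi> x\<close> with \<open>t = R' / norm x\<close>.\<close>

lemma linear_growth_of_coercive:
  assumes "cone V" and coercive: "\<And>B. \<exists>R. \<forall>x\<in>V. R \<le> norm x \<longrightarrow> B \<le> \<phi> x"
  shows "\<exists>c>0. \<exists>R. \<forall>x\<in>V. R \<le> norm x \<longrightarrow> c * norm x \<le> \<phi> x"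
proof -
  obtain M where M: "M \<ge> 0"
    "\<And>x t. 0 \<le> t \<Longrightarrow> t \<le> 1 \<Longrightarrow> \<phi> (t *\<^sub>R x) \<le> K\<^sup>2 * t * \<phi> x + M"
    using scaling_bound by blast
  obtain R where R: "\<And>x. x \<in> V \<Longrightarrow> R \<le> norm x \<Longrightarrow> M + 1 \<le> \<phi> x"
    using coercive by blast
  define R' where "R' = max R 1"
  have R': "R' \<ge> R" "R' \<ge> 1" by (auto simp: R'_def)
  have "1 / (K\<^sup>2 * R') * norm x \<le> \<phi> x" if "x \<in> V" "R' \<le> norm x" for x
  proof -
    have "norm x > 0" using that R' by linarith
    define t where "t = R' / norm x"
    have t: "0 \<le> t" "t \<le> 1" using that R' \<open>norm x > 0\<close> by (auto simp: t_def)
    have "norm (t *\<^sub>R x) = R'" using R' \<open>norm x > 0\<close> by (simp add: t_def)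
    moreover have "t *\<^sub>R x \<in> V" using \<open>cone V\<close> that t by (simp add: cone_def)
    ultimately have "M + 1 \<le> \<phi> (t *\<^sub>R x)" using R' by (intro R) auto
    with M(2)[OF t, of x] have "1 \<le> K\<^sup>2 * t * \<phi> x" by linarith
    then show ?thesis using R' K_pos \<open>norm x > 0\<close> by (simp add: t_def field_simps)
  qed
  moreover have "1 / (K\<^sup>2 * R') > 0" using R' K_pos by simp
  ultimately show ?thesis by blast
qed

text \<open>
  On a piece, Hoffman's bound for the homogenised system puts \<open>x\<close> within \<open>O(1 + \<phi> x)\<close> of a
  direction in \<open>recession_cone \<Omega>\<close>, which itself is within \<open>O(1)\<close> of \<open>\<Omega>\<close>; the constant is absorbed
  wherever \<open>\<phi>\<close> is bounded away from \<open>0\<close>, and elsewhere the local bound applies.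
\<close>

lemma error_bound_recession:
  assumes V: "finite_union_polyhedra V"
    and incl: "nonpos_set (recession_fun \<phi>) \<inter> recession_cone V \<subseteq> recession_cone \<Omega>"
  shows "\<exists>\<tau>>0. \<forall>x\<in>V. \<tau> * infdist x \<Omega> \<le> \<phi> x"
proof -
  obtain \<P> where \<P>: "finite \<P>" "\<forall>P\<in>\<P>. polyhedron P" "V = \<Union>\<P>"
    using V unfolding finite_union_polyhedra_def by blast
  obtain c where c: "c > 0" "\<And>x. c \<le> \<phi> x \<or> c * infdist x \<Omega> \<le> \<phi> x"
    using local_error_bound by blast
  obtain M where M: "M \<ge> 0" "\<And>z. z \<in> recession_cone \<Omega> \<Longrightarrow> infdist z \<Omega> \<le> M"
    using infdist_recession_cone by blast
  define T where "T = (\<lambda>(P, H, A :: ('a \<times> real) set) \<tau>.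
    \<forall>x\<in>P \<inter> solutions H. \<tau> * infdist x \<Omega> \<le> \<phi> x)"
  have "\<exists>\<tau>>0. \<forall>u\<in>\<P> \<times> Q. T u \<tau>"
  proof (rule finite_uniform_pos)
    show "finite (\<P> \<times> Q)" using \<P>(1) finite_Q by simp
    show "T u \<tau>'" if "T u \<tau>" "0 < \<tau>'" "\<tau>' \<le> \<tau>" for u \<tau> \<tau>'
      using that unfolding T_def
      by (auto simp: case_prod_unfold intro: order_trans[OF mult_right_mono[OF _ infdist_nonneg]])
    fix u assume "u \<in> \<P> \<times> Q"
    then obtain P H A where [simp]: "u = (P, H, A)" and "P \<in> \<P>" and q: "(H, A) \<in> Q" by auto
    obtain W where W: "finite W" "P = solutions W"
      using \<P>(2) \<open>P \<in> \<P>\<close> polyhedron_eq_solutions by metis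
    show "\<exists>\<tau>>0. T u \<tau>"
    proof (cases "P \<inter> solutions H = {}")
      case True
      then show ?thesis by (intro exI[of _ 1]) (simp add: T_def)
    next
      case False
      then obtain p where p: "p \<in> solutions W" "p \<in> solutions H" using W by blast
      define I where "I = W \<union> H \<union> A"
      have fin: "finite I" "finite A" using W finite_rows[OF q] by (auto simp: I_def)
      \<comment> \<open>The ray from \<open>p\<close> along \<open>z\<close> stays in
        \<open>P\<close> and in the piece, and the rows in \<open>A\<close> stay bounded above on
        it; hence so does \<open>\<phi>\<close>, and the assumed inclusion applies to
        \<open>z\<close>.\<close>
      have rec: "z \<in> recession_cone \<Omega>" if z: "z \<in> recession_dirs I" for z
      proof -
        have zs: "z \<in> recession_dirs W" "z \<in> recession_dirs H" "z \<in> recession_dirs A"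
          using z by (auto simp: I_def recession_dirs_Un)
        have "p + t *\<^sub>R z \<in> V" if "t \<ge> 0" for t
          using solutions_add_recession[OF p(1) zs(1) that] W \<P> \<open>P \<in> \<P>\<close> by blast
        moreover from this[of 0] have "p \<in> V" by simp
        ultimately have "z \<in> recession_cone V" unfolding recession_cone_def by blast
        moreover have "\<phi> (p + t *\<^sub>R z) \<le> K * (\<Sum>h\<in>A. \<bar>fst h \<bullet> p\<bar> + \<bar>snd h\<bar>)" if "t \<ge> 0" for t
        proof (rule phi_le[OF q solutions_add_recession[OF p(2) zs(2) that]])
          show "\<forall>h\<in>A. fst h \<bullet> (p + t *\<^sub>R z) \<le> snd h + (\<Sum>h\<in>A. \<bar>fst h \<bullet> p\<bar> + \<bar>snd h\<bar>)"
          proof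
            fix h assume h: "h \<in> A"
            have "\<bar>fst h \<bullet> p\<bar> + \<bar>snd h\<bar> \<le> (\<Sum>h\<in>A. \<bar>fst h \<bullet> p\<bar> + \<bar>snd h\<bar>)"
              using member_le_sum[of h A "\<lambda>h. \<bar>fst h \<bullet> p\<bar> + \<bar>snd h\<bar>"] fin h by simp
            moreover have "t * (fst h \<bullet> z) \<le> 0"
              using zs(3) h that by (auto simp: recession_dirs_def mult_le_0_iff)
            ultimately show "fst h \<bullet> (p + t *\<^sub>R z) \<le> snd h + (\<Sum>h\<in>A. \<bar>fst h \<bullet> p\<bar> + \<bar>snd h\<bar>)"
              by (simp add: inner_add_right)
          qed
        qed (simp add: sum_nonneg)
        then have "recession_fun \<phi> z \<le> 0" by (rule recession_fun_nonpos)
        ultimately show ?thesis using incl by (auto simp: nonpos_set_def)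
      qed
      obtain C where C: "C \<ge> 0"
        "\<And>b x r. \<exists>y. \<forall>i\<in>I. fst i \<bullet> y \<le> b i \<Longrightarrow> 0 \<le> r \<Longrightarrow> \<forall>i\<in>I. fst i \<bullet> x \<le> b i + r \<Longrightarrow>
          \<exists>y. (\<forall>i\<in>I. fst i \<bullet> y \<le> b i) \<and> norm (x - y) \<le> C * r"
        using Hoffman[OF fin(1), of fst] by blast
      define R where "R = (\<Sum>h\<in>I. \<bar>snd h\<bar>)"
      have "R \<ge> 0" by (simp add: R_def sum_nonneg)
      have R: "snd h \<le> R" if "h \<in> I" for h
        using member_le_sum[of h I "\<lambda>h. \<bar>snd h\<bar>"] fin that by (simp add: R_def)
      \<comment> \<open>The part \<open>C * R + M\<close> of the distance estimate does not involve
        \<open>\<phi>\<close>; where \<open>c \<le> \<phi> x\<close> it is absorbed through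
        \<open>1 \<le> \<phi> x / c\<close>.\<close>
      define D where "D = (C * R + M) / c + C * K"
      have "D \<ge> 0" using C(1) M(1) c(1) K_pos \<open>R \<ge> 0\<close> by (simp add: D_def)
      have far: "infdist x \<Omega> \<le> D * \<phi> x" if x: "x \<in> solutions W" "x \<in> solutions H" and "c \<le> \<phi> x" for x
      proof -
        have Kphi: "0 \<le> K * \<phi> x" using K_pos phi_nonneg by simp
        have "\<exists>y::'a. \<forall>h\<in>I. fst h \<bullet> y \<le> 0" by (rule exI[of _ 0]) simp
        moreover have "\<forall>h\<in>I. fst h \<bullet> x \<le> 0 + (R + K * \<phi> x)"
        proof
          fix h assume h: "h \<in> I"
          then have "fst h \<bullet> x \<le> snd h + K * \<phi> x"
            using x row_le[OF q x(2)] Kphi unfolding I_def solutions_def by fastforce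
          with R[OF h] show "fst h \<bullet> x \<le> 0 + (R + K * \<phi> x)" by linarith
        qed
        ultimately obtain k where k: "k \<in> recession_dirs I" "norm (x - k) \<le> C * (R + K * \<phi> x)"
          using C(2)[of "\<lambda>_. 0" "R + K * \<phi> x" x] \<open>R \<ge> 0\<close> Kphi by (auto simp: recession_dirs_def)
        have "infdist x \<Omega> \<le> infdist k \<Omega> + dist x k" by (rule infdist_triangle)
        also have "\<dots> \<le> (C * R + M) * 1 + C * K * \<phi> x"
          using M(2)[OF rec[OF k(1)]] k(2) by (simp add: dist_norm algebra_simps)
        also have "(C * R + M) * 1 \<le> (C * R + M) * (\<phi> x / c)"
          using C(1) M(1) c(1) \<open>R \<ge> 0\<close> \<open>c \<le> \<phi> x\<close> by (intro mult_left_mono) auto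
        finally show ?thesis by (simp add: D_def distrib_right)
      qed
      have "min c (1 / (D + 1)) * infdist x \<Omega> \<le> \<phi> x"
        if x: "x \<in> solutions W" "x \<in> solutions H" for x
        using c(2)[of x]
      proof
        assume "c \<le> \<phi> x"
        then have "infdist x \<Omega> \<le> (D + 1) * \<phi> x"
          using far[OF x] phi_nonneg[of x] by (simp add: algebra_simps)
        then have "1 / (D + 1) * infdist x \<Omega> \<le> \<phi> x"
          using \<open>D \<ge> 0\<close> by (simp add: field_simps)
        moreover have "min c (1 / (D + 1)) * infdist x \<Omega> \<le> 1 / (D + 1) * infdist x \<Omega>"
          by (intro mult_right_mono infdist_nonneg) simp
        ultimately show ?thesis by linarith
      next
        assume "c * infdist x \<Omega> \<le> \<phi> x"
        moreover have "min c (1 / (D + 1)) * infdist x \<Omega> \<le> c * infdist x \<Omega>"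
          by (intro mult_right_mono infdist_nonneg) simp
        ultimately show ?thesis by linarith
      qed
      moreover have "min c (1 / (D + 1)) > 0" using c(1) \<open>D \<ge> 0\<close> by simp
      ultimately show ?thesis
        using W by (intro exI[of _ "min c (1 / (D + 1))"]) (simp add: T_def)
    qed
  qed
  then obtain \<tau> where \<tau>: "\<tau> > 0" "\<And>u. u \<in> \<P> \<times> Q \<Longrightarrow> T u \<tau>" by blast
  have "\<tau> * infdist x \<Omega> \<le> \<phi> x" if "x \<in> V" for x
  proof -
    have "x \<in> \<Union>\<P>" using \<P>(3) that by simp
    then obtain P where "P \<in> \<P>" "x \<in> P" by blast
    moreover obtain H A where "(H, A) \<in> Q" "x \<in> solutions H" using cover[of x] by auto
    ultimately show ?thesis using \<tau>(2)[of "(P, H, A)"] by (auto simp: T_def)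
  qed
  with \<tau>(1) show ?thesis by blast
qed

section \<open>Consequences of the error bound at infinity\<close>

text \<open>The error bound turns smallness of \<open>\<phi> (x n)\<close> relative to
  \<open>t n\<close> into smallness of the distance to \<open>\<Omega>\<close>, as
  \<open>asymptotic_direction\<close> requires. The majorant \<open>e\<close> lets each use supply
  only an inequality.\<close>

lemma asymptotic_recession_cone:
  assumes "\<tau> > 0" and eb: "\<And>n. \<tau> * infdist (x n) \<Omega> \<le> \<phi> (x n)"
    and t: "filterlim t at_top sequentially"
    and x: "(\<lambda>n. x n /\<^sub>R t n) \<longlonglongrightarrow> z"
    and bound: "\<forall>\<^sub>F n in sequentially. \<phi> (x n) / t n \<le> e n" and e: "e \<longlonglongrightarrow> 0"
  shows "z \<in> recession_cone \<Omega>"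
  unfolding recession_cone_Omega
proof (intro CollectI asymptotic_direction[OF t x])
  have t_pos: "\<forall>\<^sub>F n in sequentially. t n > 0"
    using t by (simp add: filterlim_at_top_dense)
  show "(\<lambda>n. infdist (x n) \<Omega> / t n) \<longlonglongrightarrow> 0"
  proof (rule Lim_null_comparison)
    show "(\<lambda>n. e n / \<tau>) \<longlonglongrightarrow> 0" using tendsto_divide[OF e tendsto_const[of \<tau>]] \<open>\<tau> > 0\<close> by simp
    show "\<forall>\<^sub>F n in sequentially. norm (infdist (x n) \<Omega> / t n) \<le> e n / \<tau>"
      using bound t_pos
    proof eventually_elim
      case (elim n)
      have "\<tau> * infdist (x n) \<Omega> / t n \<le> \<phi> (x n) / t n"
        using eb[of n] elim by (simp add: divide_right_mono)
      with elim have "\<tau> * (infdist (x n) \<Omega> / t n) \<le> e n" by simp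
      then have "infdist (x n) \<Omega> / t n \<le> e n / \<tau>"
        using \<open>\<tau> > 0\<close> by (simp add: pos_le_divide_eq mult.commute)
      then show ?case using elim infdist_nonneg[of "x n" \<Omega>] by simp
    qed
  qed
qed

text \<open>The error bound is tested along the ray \<open>v + real (Suc n) *\<^sub>R z\<close> in
  \<open>V\<close>. There \<open>\<phi>\<close> differs by at most \<open>L * norm v\<close> from
  its value on the ray through the origin, whose slope is 0 since \<open>\<phi>\<close> is
  nonnegative.\<close>

lemma recession_inclusion_of_error_bound:
  assumes "\<tau> > 0" and eb: "\<And>x. x \<in> V \<Longrightarrow> \<tau> * infdist x \<Omega> \<le> \<phi> x"
  shows "nonpos_set (recession_fun \<phi>) \<inter> recession_cone V \<subseteq> recession_cone \<Omega>"
proof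
  fix z assume z: "z \<in> nonpos_set (recession_fun \<phi>) \<inter> recession_cone V"
  then obtain v where v: "\<And>t. t \<ge> 0 \<Longrightarrow> v + t *\<^sub>R z \<in> V" by (auto simp: recession_cone_def)
  have lim: "(\<lambda>n. 1 / real (Suc n)) \<longlonglongrightarrow> 0" by (intro LIMSEQ_Suc lim_1_over_n)
  have top: "filterlim (\<lambda>n. real (Suc n)) at_top sequentially"
    by (intro filterlim_compose[OF filterlim_real_sequentially filterlim_Suc])
  have rz: "(\<lambda>n. \<phi> (real (Suc n) *\<^sub>R z) / real (Suc n)) \<longlonglongrightarrow> recession_fun \<phi> z"
    by (rule filterlim_compose[OF recession_fun_tendsto top])
  have "recession_fun \<phi> z \<ge> 0"
    by (rule tendsto_lowerbound[OF rz]) (auto simp: phi_nonneg)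
  with z have r0: "recession_fun \<phi> z = 0" by (simp add: nonpos_set_def)
  show "z \<in> recession_cone \<Omega>"
  proof (rule asymptotic_recession_cone[OF \<open>\<tau> > 0\<close> _ top])
    show "\<tau> * infdist (v + real (Suc n) *\<^sub>R z) \<Omega> \<le> \<phi> (v + real (Suc n) *\<^sub>R z)" for n
      by (intro eb v) simp
    have "(\<lambda>n. (1 / real (Suc n)) *\<^sub>R v + z) \<longlonglongrightarrow> 0 *\<^sub>R v + z"
      by (intro tendsto_intros lim)
    moreover have "(v + real (Suc n) *\<^sub>R z) /\<^sub>R real (Suc n) = (1 / real (Suc n)) *\<^sub>R v + z" for n
      by (simp add: scaleR_add_right inverse_eq_divide del: of_nat_Suc)
    ultimately show "(\<lambda>n. (v + real (Suc n) *\<^sub>R z) /\<^sub>R real (Suc n)) \<longlonglongrightarrow> z" by simp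
    show "\<forall>\<^sub>F n in sequentially. \<phi> (v + real (Suc n) *\<^sub>R z) / real (Suc n)
      \<le> \<phi> (real (Suc n) *\<^sub>R z) / real (Suc n) + L * norm v * (1 / real (Suc n))"
    proof (rule always_eventually, rule allI)
      fix n
      have "\<phi> (v + real (Suc n) *\<^sub>R z) \<le> \<phi> (real (Suc n) *\<^sub>R z) + L * norm v"
        using phi_Lipschitz[of "v + real (Suc n) *\<^sub>R z" "real (Suc n) *\<^sub>R z"] by simp
      then have "\<phi> (v + real (Suc n) *\<^sub>R z) / real (Suc n)
        \<le> (\<phi> (real (Suc n) *\<^sub>R z) + L * norm v) / real (Suc n)"
        by (intro divide_right_mono) auto
      then show "\<phi> (v + real (Suc n) *\<^sub>R z) / real (Suc n)
        \<le> \<phi> (real (Suc n) *\<^sub>R z) / real (Suc n) + L * norm v * (1 / real (Suc n))"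
        by (simp add: add_divide_distrib)
    qed
    show "(\<lambda>n. \<phi> (real (Suc n) *\<^sub>R z) / real (Suc n) + L * norm v * (1 / real (Suc n))) \<longlonglongrightarrow> 0"
      using tendsto_add[OF rz tendsto_mult_left[OF lim, of "L * norm v"]] r0 by simp
  qed
qed

text \<open>Points of \<open>V\<close> that violate growth at ever smaller rates, once normalised,
  accumulate at a unit vector \<open>y\<close>. It is a limit of points of the cone hull, and a
  recession direction of \<open>\<Omega>\<close> because \<open>\<phi>\<close> is negligible against
  the norm at these points.\<close>

lemma linear_growth_of_error_bound:
  assumes "\<tau> > 0" and eb: "\<And>x. x \<in> V \<Longrightarrow> \<tau> * infdist x \<Omega> \<le> \<phi> x"
    and triv: "recession_cone \<Omega> \<inter> closure (cone hull V) = {0}"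
  shows "\<exists>c>0. \<exists>R. \<forall>x\<in>V. R \<le> norm x \<longrightarrow> c * norm x \<le> \<phi> x"
proof (rule ccontr)
  assume neg: "\<not> ?thesis"
  have "\<exists>x\<in>V. real (Suc n) \<le> norm x \<and> \<phi> x < (1 / real (Suc n)) * norm x" for n
  proof (rule ccontr)
    assume "\<not> ?thesis"
    then have "\<forall>x\<in>V. real (Suc n) \<le> norm x \<longrightarrow> (1 / real (Suc n)) * norm x \<le> \<phi> x"
      by (auto simp: not_less)
    moreover have "1 / real (Suc n) > 0" by simp
    ultimately show False using neg by blast
  qed
  then obtain x where x: "\<And>n. x n \<in> V" "\<And>n. real (Suc n) \<le> norm (x n)"
    "\<And>n. \<phi> (x n) < (1 / real (Suc n)) * norm (x n)" by metis
  have nz: "norm (x n) > 0" for n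
    using x(2)[of n] by (rule less_le_trans[rotated]) simp
  define u where "u n = x n /\<^sub>R norm (x n)" for n
  have "norm (u n) = 1" for n using nz[of n] by (simp add: u_def)
  then have "\<forall>n. u n \<in> sphere 0 1" by simp
  then obtain y s where s: "y \<in> sphere 0 1" "strict_mono s"
    "(u \<circ> s) \<longlonglongrightarrow> y"
    using compact_sphere[of "0::'a" 1] unfolding compact_def by metis
  have top: "filterlim (\<lambda>n. norm (x n)) at_top sequentially"
  proof (rule filterlim_at_top_mono)
    show "filterlim (\<lambda>n. real (Suc n)) at_top sequentially"
      by (intro filterlim_compose[OF filterlim_real_sequentially filterlim_Suc])
  qed (use x in auto)
  have "y \<in> recession_cone \<Omega>"
  proof (rule asymptotic_recession_cone[OF \<open>\<tau> > 0\<close>])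
    show "\<tau> * infdist (x (s n)) \<Omega> \<le> \<phi> (x (s n))" for n using x eb by blast
    show "filterlim (\<lambda>n. norm (x (s n))) at_top sequentially"
      by (rule filterlim_compose[OF top filterlim_subseq[OF s(2)]])
    show "(\<lambda>n. x (s n) /\<^sub>R norm (x (s n))) \<longlonglongrightarrow> y" using s(3) by (simp add: o_def u_def)
    have "(\<lambda>n. 1 / real (Suc n)) \<longlonglongrightarrow> 0" by (intro LIMSEQ_Suc lim_1_over_n)
    then show "(\<lambda>n. 1 / real (Suc (s n))) \<longlonglongrightarrow> 0"
      by (rule LIMSEQ_subseq_LIMSEQ[OF _ s(2), unfolded o_def])
    show "\<forall>\<^sub>F n in sequentially. \<phi> (x (s n)) / norm (x (s n)) \<le> 1 / real (Suc (s n))"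
      using x(3) nz by (intro always_eventually allI) (simp add: pos_divide_le_eq less_imp_le)
  qed
  moreover have "y \<in> closure (cone hull V)"
    unfolding closure_sequential
  proof (intro exI conjI allI)
    show "(u \<circ> s) n \<in> cone hull V" for n
      unfolding o_def u_def
      by (intro mem_cone[OF cone_cone_hull] hull_inc x(1)) simp
  qed (rule s(3))
  ultimately have "y = 0" using triv by blast
  with s(1) show False by simp
qed

end

subsection \<open>Equivalence of norms\<close>

lemma is_norm_diff:
  assumes "is_norm N"
  shows "N x \<le> N y + N (x - y)"
proof -
  have "N (y + (x - y)) \<le> N y + N (x - y)" using assms unfolding is_norm_def by blast
  then show ?thesis by simp
qed

lemma is_norm_le:
  fixes N :: "'a::euclidean_space \<Rightarrow> real"
  assumes "is_norm N"
  obtains C where "C \<ge> 0" "\<And>x. N x \<le> C * norm x"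
proof -
  have nn: "0 \<le> N x" and N0: "N x = 0 \<longleftrightarrow> x = 0" and sc: "N (c *\<^sub>R x) = \<bar>c\<bar> * N x"
    and tri: "N (x + y) \<le> N x + N y" for c x y
    using assms unfolding is_norm_def by blast+
  have N_sum: "N (\<Sum>b\<in>B. f b) \<le> (\<Sum>b\<in>B. N (f b))" for B and f :: "'a \<Rightarrow> 'a"
  proof (induction B rule: infinite_finite_induct)
    case (insert b B)
    then show ?case using tri[of "f b" "\<Sum>b\<in>B. f b"] by simp
  qed (simp_all add: iffD2[OF N0])
  have "N x \<le> (\<Sum>b\<in>Basis. N b) * norm x" for x
  proof -
    have "N x = N (\<Sum>b\<in>Basis. (x \<bullet> b) *\<^sub>R b)" by (simp add: euclidean_representation)
    also have "\<dots> \<le> (\<Sum>b\<in>Basis. N ((x \<bullet> b) *\<^sub>R b))" by (rule N_sum)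
    also have "\<dots> \<le> (\<Sum>b\<in>Basis. norm x * N b)"
      unfolding sc by (intro sum_mono mult_right_mono Basis_le_norm nn)
    finally show ?thesis by (simp add: sum_distrib_left mult.commute)
  qed
  moreover have "(\<Sum>b\<in>Basis. N b) \<ge> 0" by (intro sum_nonneg nn)
  ultimately show thesis using that by blast
qed

lemma is_norm_continuous:
  fixes N :: "'a::euclidean_space \<Rightarrow> real"
  assumes "is_norm N"
  shows "continuous_on UNIV N"
proof -
  obtain C where C: "C \<ge> 0" "\<And>x. N x \<le> C * norm x" by (rule is_norm_le[OF assms]) (rule that)
  have "C-lipschitz_on UNIV N"
  proof (rule lipschitz_onI)
    fix x y
    have "N ((-1) *\<^sub>R (x - y)) = \<bar>-1\<bar> * N (x - y)" using assms unfolding is_norm_def by blast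
    then have "N (x - y) = N (y - x)" by simp
    then show "dist (N x) (N y) \<le> C * dist x y"
      using is_norm_diff[OF assms, of x y] is_norm_diff[OF assms, of y x] C(2)[of "x - y"]
      by (simp add: dist_real_def dist_norm)
  qed (rule C)
  then show ?thesis by (rule lipschitz_on_continuous_on)
qed

lemma is_norm_equiv:
  fixes N :: "'a::euclidean_space \<Rightarrow> real"
  assumes "is_norm N"
  obtains C where "C > 0" "\<And>x. N x \<le> C * norm x" "\<And>x. norm x \<le> C * N x"
proof -
  have nn: "0 \<le> N x" and N0: "N x = 0 \<longleftrightarrow> x = 0" and sc: "N (c *\<^sub>R x) = \<bar>c\<bar> * N x" for c x
    using assms unfolding is_norm_def by blast+
  obtain C1 where C1: "C1 \<ge> 0" "\<And>x. N x \<le> C1 * norm x" by (rule is_norm_le[OF assms]) (rule that)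
  have "sphere (0::'a) 1 \<noteq> {}" by simp
  from continuous_attains_inf[OF compact_sphere this
      continuous_on_subset[OF is_norm_continuous[OF assms] subset_UNIV]]
  obtain u where u: "norm u = 1" "\<And>x. norm x = 1 \<Longrightarrow> N u \<le> N x" by auto
  have "u \<noteq> 0" using u(1) by auto
  then have "N u > 0" using nn[of u] N0[of u] by linarith
  have lo: "norm x \<le> 1 / N u * N x" for x
  proof (cases "x = 0")
    case True
    then show ?thesis using N0[of x] by simp
  next
    case False
    then have "N u \<le> N (inverse (norm x) *\<^sub>R x)" by (intro u(2)) simp
    also have "\<dots> = N x / norm x" using False by (simp only: sc) (simp add: field_simps)
    finally show ?thesis using False \<open>N u > 0\<close> by (simp add: field_simps)
  qed
  show thesis
  proof (rule that[of "max (C1 + 1) (1 / N u)"])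
    show "N x \<le> max (C1 + 1) (1 / N u) * norm x" for x
      using C1(2)[of x] mult_right_mono[of C1 "max (C1 + 1) (1 / N u)" "norm x"]
      by (simp add: le_max_iff_disj)
    show "norm x \<le> max (C1 + 1) (1 / N u) * N x" for x
      using lo[of x] mult_right_mono[OF max.cobounded2[of "1 / N u" "C1 + 1"] nn[of x]] by linarith
  qed (use C1 in simp)
qed

lemma norm_infdist_bounds:
  fixes N :: "'a::euclidean_space \<Rightarrow> real"
  assumes "is_norm N" "\<Omega> \<noteq> {}" "C > 0"
    and up: "\<And>x. N x \<le> C * norm x" and lo: "\<And>x. norm x \<le> C * N x"
  shows "norm_infdist N x \<Omega> \<le> C * infdist x \<Omega>" and "infdist x \<Omega> \<le> C * norm_infdist N x \<Omega>"
proof -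
  have nn: "0 \<le> N x" for x using assms(1) unfolding is_norm_def by blast
  have bdd: "bdd_below ((\<lambda>y. N (x - y)) ` \<Omega>)" by (rule bdd_belowI2[of _ 0]) (rule nn)
  have "norm_infdist N x \<Omega> / C \<le> infdist x \<Omega>"
    unfolding infdist_notempty[OF \<open>\<Omega> \<noteq> {}\<close>]
  proof (rule cINF_greatest[OF \<open>\<Omega> \<noteq> {}\<close>])
    fix y assume "y \<in> \<Omega>"
    then have "norm_infdist N x \<Omega> \<le> N (x - y)"
      unfolding norm_infdist_def by (rule cINF_lower[OF bdd])
    also have "\<dots> \<le> C * dist x y" using up by (simp add: dist_norm)
    finally show "norm_infdist N x \<Omega> / C \<le> dist x y" using \<open>C > 0\<close> by (simp add: field_simps)
  qed
  then show "norm_infdist N x \<Omega> \<le> C * infdist x \<Omega>" using \<open>C > 0\<close> by (simp add: field_simps)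
  have "infdist x \<Omega> / C \<le> norm_infdist N x \<Omega>"
    unfolding norm_infdist_def
  proof (rule cINF_greatest[OF \<open>\<Omega> \<noteq> {}\<close>])
    fix y assume "y \<in> \<Omega>"
    then have "infdist x \<Omega> \<le> norm (x - y)" using infdist_le[of y \<Omega> x] by (simp add: dist_norm)
    also have "\<dots> \<le> C * N (x - y)" by (rule lo)
    finally show "infdist x \<Omega> / C \<le> N (x - y)" using \<open>C > 0\<close> by (simp add: field_simps)
  qed
  then show "infdist x \<Omega> \<le> C * norm_infdist N x \<Omega>" using \<open>C > 0\<close> by (simp add: field_simps)
qed

lemma ex_error_bound_iff:
  fixes N :: "'a::euclidean_space \<Rightarrow> real"
  assumes "is_norm N" "\<Omega> \<noteq> {}"
  shows "(\<exists>\<tau>>0. error_bound N \<Omega> V \<phi> \<tau>) \<longleftrightarrow> (\<exists>\<tau>>0. \<forall>x\<in>V. \<tau> * infdist x \<Omega> \<le> \<phi> x)"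
proof -
  obtain C where C: "C > 0" "\<And>x. N x \<le> C * norm x" "\<And>x. norm x \<le> C * N x"
    by (rule is_norm_equiv[OF assms(1)]) (rule that)
  note b = norm_infdist_bounds[OF assms C]
  show ?thesis
  proof (intro iffI; elim exE conjE)
    fix \<tau> :: real assume "\<tau> > 0" and \<tau>: "error_bound N \<Omega> V \<phi> \<tau>"
    have "\<tau> / C * infdist x \<Omega> \<le> \<phi> x" if "x \<in> V" for x
    proof -
      have "\<tau> / C * infdist x \<Omega> \<le> \<tau> / C * (C * norm_infdist N x \<Omega>)"
        using \<open>\<tau> > 0\<close> C(1) by (intro mult_left_mono b) auto
      also have "\<dots> \<le> \<phi> x" using \<tau> that C(1) by (simp add: error_bound_def)
      finally show ?thesis .
    qed
    then show "\<exists>\<tau>>0. \<forall>x\<in>V. \<tau> * infdist x \<Omega> \<le> \<phi> x"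
      using \<open>\<tau> > 0\<close> C(1) by (intro exI[of _ "\<tau> / C"]) auto
  next
    fix \<tau> :: real assume "\<tau> > 0" and \<tau>: "\<forall>x\<in>V. \<tau> * infdist x \<Omega> \<le> \<phi> x"
    have "\<tau> / C * norm_infdist N x \<Omega> \<le> \<phi> x" if "x \<in> V" for x
    proof -
      have "\<tau> / C * norm_infdist N x \<Omega> \<le> \<tau> / C * (C * infdist x \<Omega>)"
        using \<open>\<tau> > 0\<close> C(1) by (intro mult_left_mono b) auto
      also have "\<dots> \<le> \<phi> x" using \<tau> that C(1) by simp
      finally show ?thesis .
    qed
    then show "\<exists>\<tau>>0. error_bound N \<Omega> V \<phi> \<tau>"
      using \<open>\<tau> > 0\<close> C(1) by (intro exI[of _ "\<tau> / C"]) (auto simp: error_bound_def)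
  qed
qed

section \<open>Lower limits and coercivity as Euclidean growth\<close>

text \<open>For bounded \<open>V\<close> both sides are true: the filter is trivial, so the lower
  limit is \<infinity>, and the growth condition is vacuous for large \<open>R\<close>.\<close>

lemma Liminf_pos_iff_linear_growth:
  fixes N :: "'a::euclidean_space \<Rightarrow> real"
  assumes "is_norm N"
  shows "Liminf (at_infinity_within N V) (\<lambda>x. ereal (\<phi> x / N x)) > 0 \<longleftrightarrow>
    (\<exists>c>0. \<exists>R. \<forall>x\<in>V. R \<le> norm x \<longrightarrow> c * norm x \<le> \<phi> x)"
proof -
  obtain C where C: "C > 0" "\<And>x. N x \<le> C * norm x" "\<And>x. norm x \<le> C * N x"
    by (rule is_norm_equiv[OF assms(1)]) (rule that)
  have ev: "eventually P (at_infinity_within N V) \<longleftrightarrow> (\<exists>R. \<forall>x\<in>V. R \<le> N x \<longrightarrow> P x)" for P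
    unfolding at_infinity_within_def eventually_inf_principal eventually_filtercomap_at_top_linorder
    by blast
  show ?thesis
  proof
    assume "Liminf (at_infinity_within N V) (\<lambda>x. ereal (\<phi> x / N x)) > 0"
    then obtain c where c: "0 < ereal c"
      "ereal c < Liminf (at_infinity_within N V) (\<lambda>x. ereal (\<phi> x / N x))"
      using ereal_dense2 by blast
    from less_LiminfD[OF c(2)] obtain R where
      R: "\<And>x. x \<in> V \<Longrightarrow> R \<le> N x \<Longrightarrow> c < \<phi> x / N x" unfolding ev by auto
    \<comment> \<open>The maximum with 1 ensures \<open>N x > 0\<close>, so that the quotient can be
      cleared.\<close>
    have "c / C * norm x \<le> \<phi> x" if "x \<in> V" "C * max R 1 \<le> norm x" for x
    proof -
      have "C * max R 1 \<le> C * N x" using that C(3)[of x] by linarith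
      then have Nx: "R \<le> N x" "N x > 0" using C(1) by auto
      have "c / C * norm x \<le> c / C * (C * N x)"
        using c(1) C(1) by (intro mult_left_mono C) auto
      also have "\<dots> \<le> \<phi> x" using R[OF that(1) Nx(1)] Nx C(1) by (simp add: field_simps)
      finally show ?thesis .
    qed
    then show "\<exists>c>0. \<exists>R. \<forall>x\<in>V. R \<le> norm x \<longrightarrow> c * norm x \<le> \<phi> x"
      using c(1) C(1) by (intro exI[of _ "c / C"] conjI exI[of _ "C * max R 1"]) auto
  next
    assume "\<exists>c>0. \<exists>R. \<forall>x\<in>V. R \<le> norm x \<longrightarrow> c * norm x \<le> \<phi> x"
    then obtain c R where "c > 0" and R: "\<And>x. x \<in> V \<Longrightarrow> R \<le> norm x \<Longrightarrow> c * norm x \<le> \<phi> x" by blast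
    have "c / C \<le> \<phi> x / N x" if "x \<in> V" "C * max R 1 \<le> N x" for x
    proof -
      have "C * max R 1 \<le> C * norm x" using that C(2)[of x] by linarith
      then have "R \<le> norm x" using C(1) by auto
      have "N x > 0" using that(2) C(1) by (smt (verit) mult_pos_pos)
      have "c * N x \<le> c * (C * norm x)" using \<open>c > 0\<close> by (intro mult_left_mono C) auto
      also have "\<dots> \<le> C * \<phi> x" using R[OF that(1) \<open>R \<le> norm x\<close>] C(1) by (simp add: mult.left_commute)
      finally show ?thesis using \<open>N x > 0\<close> C(1) by (simp add: field_simps)
    qed
    then have "ereal (c / C) \<le> Liminf (at_infinity_within N V) (\<lambda>x. ereal (\<phi> x / N x))"
      by (intro Liminf_bounded) (auto simp: ev)
    moreover have "0 < ereal (c / C)" using \<open>c > 0\<close> C(1) by simp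
    ultimately show "Liminf (at_infinity_within N V) (\<lambda>x. ereal (\<phi> x / N x)) > 0" by order
  qed
qed

text \<open>If the uniform bound failed for some \<open>B\<close>, choosing a bad point for each
  radius \<open>n\<close> would give a sequence contradicting sequential coercivity.\<close>

lemma coercive_on_lower_bound:
  fixes N :: "'a::euclidean_space \<Rightarrow> real"
  assumes "is_norm N" and coercive: "coercive_on N V \<phi>"
  shows "\<exists>R. \<forall>x\<in>V. R \<le> norm x \<longrightarrow> B \<le> \<phi> x"
proof (rule ccontr)
  assume "\<not> ?thesis"
  then have "\<forall>n. \<exists>x\<in>V. real n \<le> norm x \<and> \<phi> x < B" by (auto simp: not_le)
  then obtain x where x: "\<And>n. x n \<in> V" "\<And>n. real n \<le> norm (x n)" "\<And>n. \<phi> (x n) < B" by metis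
  obtain C where C: "C > 0" "\<And>x. N x \<le> C * norm x" "\<And>x. norm x \<le> C * N x"
    by (rule is_norm_equiv[OF assms(1)]) (rule that)
  have "filterlim (\<lambda>n. N (x n)) at_top sequentially"
  proof (rule filterlim_at_top_mono)
    show "filterlim (\<lambda>n. 1 / C * real n) at_top sequentially"
      using C(1) by (intro filterlim_tendsto_pos_mult_at_top[OF tendsto_const]
          filterlim_real_sequentially) simp
    have "1 / C * real n \<le> N (x n)" for n
      using order_trans[OF x(2) C(3)] C(1) by (simp add: field_simps)
    then show "\<forall>\<^sub>F n in sequentially. 1 / C * real n \<le> N (x n)" by simp
  qed
  with coercive x(1) have "filterlim (\<lambda>n. \<phi> (x n)) at_top sequentially"
    unfolding coercive_on_def by blast
  then have "\<forall>\<^sub>F n in sequentially. B \<le> \<phi> (x n)" by (simp add: filterlim_at_top)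
  then show False using x(3) by (auto simp: eventually_sequentially not_le[symmetric])
qed

lemma coercive_on_of_linear_growth:
  fixes N :: "'a::euclidean_space \<Rightarrow> real"
  assumes "is_norm N" "c > 0" and R: "\<And>x. x \<in> V \<Longrightarrow> R \<le> norm x \<Longrightarrow> c * norm x \<le> \<phi> x"
  shows "coercive_on N V \<phi>"
  unfolding coercive_on_def
proof (intro allI impI, elim conjE)
  fix x :: "nat \<Rightarrow> 'a" assume x: "\<forall>n. x n \<in> V" and lim: "filterlim (\<lambda>n. N (x n)) at_top sequentially"
  obtain C where C: "C > 0" "\<And>x. N x \<le> C * norm x" "\<And>x. norm x \<le> C * N x"
    by (rule is_norm_equiv[OF assms(1)]) (rule that)
  have bound: "1 / C * N y \<le> norm y" for y
    using C(2)[of y] C(1) by (simp add: field_simps)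
  have "filterlim (\<lambda>n. 1 / C * N (x n)) at_top sequentially"
    using C(1) by (intro filterlim_tendsto_pos_mult_at_top[OF tendsto_const] lim) simp
  then have norm_lim: "filterlim (\<lambda>n. norm (x n)) at_top sequentially"
    by (rule filterlim_at_top_mono) (intro always_eventually allI bound)
  show "filterlim (\<lambda>n. \<phi> (x n)) at_top sequentially"
  proof (rule filterlim_at_top_mono)
    show "filterlim (\<lambda>n. c * norm (x n)) at_top sequentially"
      by (rule filterlim_tendsto_pos_mult_at_top[OF tendsto_const \<open>c > 0\<close> norm_lim])
    have "\<forall>\<^sub>F n in sequentially. R \<le> norm (x n)" using norm_lim by (simp add: filterlim_at_top)
    then show "\<forall>\<^sub>F n in sequentially. c * norm (x n) \<le> \<phi> (x n)"
      by eventually_elim (use x R in blast)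
  qed
qed

subsection \<open>Piecewise affine maps\<close>

text \<open>The minus sign makes a component row a half-space in the format of
  \<open>solutions\<close>: on the piece, \<open>H x $ i \<le> 0\<close> says that \<open>x\<close>
  satisfies the row \<open>snd q i\<close>.\<close>

definition affine_pieces ::
    "('a::euclidean_space \<Rightarrow> real ^ 'n) \<Rightarrow> (('a \<times> real) set \<times> ('n \<Rightarrow> 'a \<times> real)) set \<Rightarrow> bool" where
  "affine_pieces H \<P> \<longleftrightarrow> finite \<P> \<and>
    (\<forall>q\<in>\<P>. finite (fst q) \<and>
      (\<forall>x\<in>solutions (fst q). \<forall>i. H x $ i = fst (snd q i) \<bullet> x - snd (snd q i))) \<and>
    (\<forall>x. \<exists>q\<in>\<P>. x \<in> solutions (fst q))"

lemma affine_pieces_cover: "affine_pieces H \<P> \<Longrightarrow> \<exists>q\<in>\<P>. x \<in> solutions (fst q)"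
  unfolding affine_pieces_def by simp

lemma affine_pieces_component:
  "affine_pieces H \<P> \<Longrightarrow> q \<in> \<P> \<Longrightarrow> x \<in> solutions (fst q) \<Longrightarrow>
    H x $ i = fst (snd q i) \<bullet> x - snd (snd q i)"
  unfolding affine_pieces_def by blast

lemma affine_map_component:
  fixes h :: "'a::euclidean_space \<Rightarrow> real ^ 'n"
  assumes "affine_map h"
  obtains \<alpha> where "\<And>x i. h x $ i = fst (\<alpha> i) \<bullet> x - snd (\<alpha> i)"
proof -
  obtain L c where L: "linear L" "\<And>x. h x = L x + c" using assms unfolding affine_map_def by blast
  have "h x $ i = adjoint L (axis i 1) \<bullet> x - (- c $ i)" for x i
    using adjoint_works[OF L(1), of x "axis i 1"] L(2)[of x] by (simp add: inner_axis inner_commute)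
  then show thesis by (intro that[of "\<lambda>i. (adjoint L (axis i 1), - c $ i)"]) auto
qed

lemma piecewise_affine_imp_affine_pieces:
  fixes H :: "'a::euclidean_space \<Rightarrow> real ^ 'n"
  assumes "piecewise_affine H"
  obtains \<P> where "affine_pieces H \<P>"
proof -
  from assms[unfolded piecewise_affine_def] obtain s :: nat and P h where
    "(\<forall>l\<in>{1..s}. polyhedron (P l) \<and> interior (P l) \<noteq> {}) \<and>
      disjoint_family_on (\<lambda>l. interior (P l)) {1..s} \<and> (\<Union>l\<in>{1..s}. P l) = UNIV \<and>
      (\<forall>l\<in>{1..s}. affine_map (h l) \<and> (\<forall>x\<in>P l. H x = h l x))"
    by (elim exE)
  then have P: "\<forall>l\<in>{1..s}. polyhedron (P l)" "(\<Union>l\<in>{1..s}. P l) = UNIV"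
    "\<forall>l\<in>{1..s}. affine_map (h l)" "\<forall>l\<in>{1..s}. \<forall>x\<in>P l. H x = h l x"
    by simp_all
  have "\<forall>l\<in>{1..s}. \<exists>S. finite S \<and> P l = solutions S"
    using P(1) polyhedron_eq_solutions by metis
  then obtain S where S: "\<And>l. l \<in> {1..s} \<Longrightarrow> finite (S l) \<and> P l = solutions (S l)" by metis
  have "\<forall>l\<in>{1..s}. \<exists>\<alpha>. \<forall>x i. h l x $ i = fst (\<alpha> i) \<bullet> x - snd (\<alpha> i)"
    using P(3) affine_map_component by metis
  then obtain \<alpha> where \<alpha>: "\<And>l x i. l \<in> {1..s} \<Longrightarrow> h l x $ i = fst (\<alpha> l i) \<bullet> x - snd (\<alpha> l i)" by metis
  have "affine_pieces H ((\<lambda>l. (S l, \<alpha> l)) ` {1..s})"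
    unfolding affine_pieces_def
  proof (intro conjI allI)
    show "\<exists>q\<in>(\<lambda>l. (S l, \<alpha> l)) ` {1..s}. x \<in> solutions (fst q)" for x
    proof -
      obtain l where "l \<in> {1..s}" "x \<in> P l" using P(2) by blast
      then show ?thesis using S by (intro bexI[of _ "(S l, \<alpha> l)"]) auto
    qed
    show "\<forall>q\<in>(\<lambda>l. (S l, \<alpha> l)) ` {1..s}. finite (fst q) \<and>
      (\<forall>x\<in>solutions (fst q). \<forall>i. H x $ i = fst (snd q i) \<bullet> x - snd (snd q i))"
      using S \<alpha> P(4) by auto
  qed simp
  then show thesis by (rule that)
qed

text \<open>Each piece has a Lipschitz constant, but two points may lie in different pieces. The
  segment between them is covered by the closed preimages of the pieces in the unit interval, and
  the bounds on these add up along it.\<close>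

lemma affine_pieces_Lipschitz:
  fixes H :: "'a::euclidean_space \<Rightarrow> real ^ 'n"
  assumes "affine_pieces H \<P>"
  shows "\<exists>L\<ge>0. \<forall>x y. norm (H x - H y) \<le> L * norm (x - y)"
proof -
  have fin: "finite \<P>" using assms by (simp add: affine_pieces_def)
  have "\<exists>L\<ge>0. \<forall>q\<in>\<P>. \<forall>x\<in>solutions (fst q). \<forall>y\<in>solutions (fst q).
    norm (H x - H y) \<le> L * norm (x - y)"
  proof (rule finite_uniform_bound[OF fin])
    fix q assume "q \<in> \<P>"
    have "norm (H x - H y) \<le> (\<Sum>i\<in>UNIV. norm (fst (snd q i))) * norm (x - y)"
      if "x \<in> solutions (fst q)" "y \<in> solutions (fst q)" for x y
    proof -
      have Hxy: "(H x - H y) $ i = fst (snd q i) \<bullet> (x - y)" for i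
        using that by (simp add: affine_pieces_component[OF assms \<open>q \<in> \<P>\<close>] inner_diff_right)
      have "norm (H x - H y) \<le> (\<Sum>i\<in>UNIV. \<bar>(H x - H y) $ i\<bar>)" by (rule norm_le_l1_cart)
      also have "\<dots> \<le> (\<Sum>i\<in>UNIV. norm (fst (snd q i)) * norm (x - y))"
        unfolding Hxy by (intro sum_mono Cauchy_Schwarz_ineq2)
      finally show ?thesis by (simp add: sum_distrib_right)
    qed
    then show "\<exists>L. \<forall>x\<in>solutions (fst q). \<forall>y\<in>solutions (fst q). norm (H x - H y) \<le> L * norm (x - y)"
      by blast
  qed (meson mult_right_mono norm_ge_zero order_trans)
  then obtain L where L: "L \<ge> 0" "\<And>q x y. q \<in> \<P> \<Longrightarrow> x \<in> solutions (fst q) \<Longrightarrow>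
    y \<in> solutions (fst q) \<Longrightarrow> norm (H x - H y) \<le> L * norm (x - y)" by blast
  have "norm (H x - H y) \<le> L * norm (x - y)" for x y
  proof -
    define g where "g t = x + t *\<^sub>R (y - x)" for t
    define U where "U q = g -` solutions (fst q)" for q :: "('a \<times> real) set \<times> ('n \<Rightarrow> 'a \<times> real)"
    have "(L * norm (x - y))-lipschitz_on {0..1} (H \<circ> g)"
    proof (rule lipschitz_on_closed_Union[OF _ _ fin])
      show "(L * norm (x - y))-lipschitz_on (U q) (H \<circ> g)" if "q \<in> \<P>" for q
      proof (rule lipschitz_onI)
        fix t u assume "t \<in> U q" "u \<in> U q"
        then have "norm (H (g t) - H (g u)) \<le> L * norm (g t - g u)"
          using L(2)[OF that] by (simp add: U_def)
        also have "g t - g u = (t - u) *\<^sub>R (y - x)" by (simp add: g_def algebra_simps)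
        finally show "dist ((H \<circ> g) t) ((H \<circ> g) u) \<le> L * norm (x - y) * dist t u"
          by (simp add: dist_norm norm_minus_commute[of y x] mult_ac)
      qed (use L in simp)
      show "closed (U q)" for q
        unfolding U_def g_def by (intro closed_vimage closed_solutions continuous_intros)
      show "{0..1} \<subseteq> (\<Union>q\<in>\<P>. U q)"
        using affine_pieces_cover[OF assms] by (auto simp: U_def)
    qed (use L in simp)
    then have "dist ((H \<circ> g) 0) ((H \<circ> g) 1) \<le> L * norm (x - y) * dist (0::real) 1"
      by (rule lipschitz_onD) auto
    then show ?thesis by (simp add: g_def dist_norm)
  qed
  with L(1) show ?thesis by blast
qed

text \<open>A ray meets the convex pieces in intervals, so it eventually stays in a single piece.\<close>

lemma affine_pieces_ray_limit:
  fixes H :: "'a::euclidean_space \<Rightarrow> real ^ 'n"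
  assumes "affine_pieces H \<P>"
  shows "\<exists>l. ((\<lambda>t. H (t *\<^sub>R x) /\<^sub>R t) \<longlongrightarrow> l) at_top"
proof -
  have "\<exists>q\<in>\<P>. t *\<^sub>R x \<in> solutions (fst q)" for t
    by (rule affine_pieces_cover[OF assms])
  then have "\<exists>\<^sub>F t in at_top. \<exists>q\<in>\<P>. t *\<^sub>R x \<in> solutions (fst q)" by simp
  from frequently_bex_finite[OF _ this]
  obtain q where q: "q \<in> \<P>" "\<exists>\<^sub>F t in at_top. t *\<^sub>R x \<in> solutions (fst q)"
    using assms unfolding affine_pieces_def by blast
  then have unbdd: "\<exists>u\<ge>t. u *\<^sub>R x \<in> solutions (fst q)" for t
    unfolding frequently_def eventually_at_top_linorder by blast
  obtain t0 where t0: "t0 *\<^sub>R x \<in> solutions (fst q)" using unbdd by blast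
  have stay: "t *\<^sub>R x \<in> solutions (fst q)" if "t0 \<le> t" for t
  proof -
    obtain u where u: "u \<ge> t" "u *\<^sub>R x \<in> solutions (fst q)" using unbdd by blast
    have "fst h \<bullet> (t *\<^sub>R x) \<le> snd h" if h: "h \<in> fst q" for h
    proof -
      have b: "t0 * (fst h \<bullet> x) \<le> snd h" "u * (fst h \<bullet> x) \<le> snd h"
        using t0 u(2) h by (auto simp: solutions_def)
      show ?thesis
      proof (cases "fst h \<bullet> x \<ge> 0")
        case True
        from mult_right_mono[OF u(1) this] b show ?thesis by simp
      next
        case False
        then show ?thesis using mult_right_mono_neg[OF \<open>t0 \<le> t\<close>, of "fst h \<bullet> x"] b(1)
            unfolding inner_scaleR_right by linarith
      qed
    qed
    then show ?thesis by (simp add: solutions_def)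
  qed
  have "((\<lambda>t. H (t *\<^sub>R x) /\<^sub>R t) \<longlongrightarrow> (\<chi> i. fst (snd q i) \<bullet> x)) at_top"
  proof (rule vec_tendstoI)
    fix i
    have "((\<lambda>t. fst (snd q i) \<bullet> x - snd (snd q i) / t) \<longlongrightarrow> fst (snd q i) \<bullet> x - 0) at_top"
      by (intro tendsto_intros real_tendsto_divide_at_top[OF tendsto_const filterlim_ident])
    moreover have "\<forall>\<^sub>F t in at_top.
      fst (snd q i) \<bullet> x - snd (snd q i) / t = (H (t *\<^sub>R x) /\<^sub>R t) $ i"
      using eventually_ge_at_top[of t0] eventually_gt_at_top[of 0]
    proof eventually_elim
      case (elim t)
      have "H (t *\<^sub>R x) $ i = t * (fst (snd q i) \<bullet> x) - snd (snd q i)"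
        using affine_pieces_component[OF assms q(1) stay[OF elim(1)]] by simp
      then show ?case using elim(2) by (simp add: field_simps)
    qed
    ultimately show "((\<lambda>t. (H (t *\<^sub>R x) /\<^sub>R t) $ i) \<longlongrightarrow> (\<chi> i. fst (snd q i) \<bullet> x) $ i) at_top"
      using Lim_transform_eventually by force
  qed
  then show ?thesis by blast
qed

lemma polyhedral_residual_piecewise_affine:
  fixes F :: "'a::euclidean_space \<Rightarrow> real ^ 'm" and G :: "'a \<Rightarrow> real ^ 'n"
    and N :: "real ^ 'm \<Rightarrow> real"
  assumes N: "is_norm N" and "piecewise_affine F" "piecewise_affine G"
    and \<Omega>: "\<Omega> = {x. F x = 0 \<and> (\<forall>i. G x $ i \<le> 0)}" "\<Omega> \<noteq> {}"
    and \<phi>: "\<phi> = (\<lambda>x. N (F x) + (\<Sum>i\<in>UNIV. max (G x $ i) 0))"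
  shows "\<exists>Q K L. polyhedral_residual \<phi> \<Omega> Q K L"
proof -
  obtain \<A> where \<A>: "affine_pieces F \<A>"
    using piecewise_affine_imp_affine_pieces[OF assms(2)] by blast
  obtain \<B> where \<B>: "affine_pieces G \<B>"
    using piecewise_affine_imp_affine_pieces[OF assms(3)] by blast
  have N_nonneg: "0 \<le> N y" and N_zero: "N y = 0 \<longleftrightarrow> y = 0"
    and N_scale: "N (c *\<^sub>R y) = \<bar>c\<bar> * N y" for y c
    using N unfolding is_norm_def by blast+
  obtain C where C: "C > 0" "\<And>y. N y \<le> C * norm y" "\<And>y. norm y \<le> C * N y"
    by (rule is_norm_equiv[OF N]) (rule that)
  obtain LF where LF: "LF \<ge> 0" "\<And>x y. norm (F x - F y) \<le> LF * norm (x - y)"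
    using affine_pieces_Lipschitz[OF \<A>] by blast
  obtain LG where LG: "LG \<ge> 0" "\<And>x y. norm (G x - G y) \<le> LG * norm (x - y)"
    using affine_pieces_Lipschitz[OF \<B>] by blast
  \<comment> \<open>The equation \<open>F x = 0\<close> becomes two inequalities per component;
    \<open>- \<alpha> i\<close> negates normal and offset together.\<close>
  define rows :: "('m \<Rightarrow> 'a \<times> real) \<Rightarrow> ('n \<Rightarrow> 'a \<times> real) \<Rightarrow> ('a \<times> real) set"
    where "rows \<alpha> \<beta> = range \<alpha> \<union> range (\<lambda>i. - \<alpha> i) \<union> range \<beta>" for \<alpha> \<beta>
  define Q where "Q = (\<lambda>(q, p). (fst q \<union> fst p, rows (snd q) (snd p))) ` (\<A> \<times> \<B>)"
  \<comment> \<open>\<open>C\<close> bounds a component of \<open>F\<close> by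
    \<open>N (F x)\<close>, 1 serves the components of \<open>G\<close>, and the first two terms
    bound \<open>\<phi>\<close> by the largest row violation.\<close>
  define K where "K = C * CARD('m) + CARD('n) + C + 1"
  define L where "L = C * LF + CARD('n) * LG"
  have QE: "\<exists>S \<alpha> T \<beta>. (S, \<alpha>) \<in> \<A> \<and> (T, \<beta>) \<in> \<B> \<and> H = S \<union> T \<and> A = rows \<alpha> \<beta>"
    if "(H, A) \<in> Q" for H A
    using that unfolding Q_def by fastforce
  have Fi: "F x $ i = fst (\<alpha> i) \<bullet> x - snd (\<alpha> i)" if "(S, \<alpha>) \<in> \<A>" "x \<in> solutions S" for S \<alpha> x i
    using affine_pieces_component[OF \<A> that(1)] that(2) by simp
  have Gi: "G x $ i = fst (\<beta> i) \<bullet> x - snd (\<beta> i)" if "(T, \<beta>) \<in> \<B>" "x \<in> solutions T" for T \<beta> x i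
    using affine_pieces_component[OF \<B> that(1)] that(2) by simp
  have \<phi>_nonneg: "\<phi> x \<ge> 0" for x
    unfolding \<phi> by (intro add_nonneg_nonneg N_nonneg sum_nonneg) auto
  have F_le: "\<bar>F x $ i\<bar> \<le> K * \<phi> x" for x i
  proof -
    have "\<bar>F x $ i\<bar> \<le> norm (F x)" by (rule component_le_norm_cart)
    also have "\<dots> \<le> C * N (F x)" by (rule C)
    also have "\<dots> \<le> K * \<phi> x"
      using C(1) unfolding K_def \<phi>
      by (intro mult_mono) (auto simp: sum_nonneg N_nonneg)
    finally show ?thesis .
  qed
  have G_le: "G x $ i \<le> K * \<phi> x" for x i
  proof -
    have "max (G x $ i) 0 \<le> (\<Sum>i\<in>UNIV. max (G x $ i) 0)" by (rule member_le_sum) auto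
    also have "\<dots> \<le> 1 * \<phi> x" by (simp add: \<phi> N_nonneg)
    also have "\<dots> \<le> K * \<phi> x" using C(1) by (intro mult_right_mono \<phi>_nonneg) (simp add: K_def)
    finally show ?thesis by simp
  qed
  have "polyhedral_residual \<phi> \<Omega> Q K L"
  proof
    show "finite Q" using \<A> \<B> by (simp add: Q_def affine_pieces_def)
    show "finite H \<and> finite A" if q: "(H, A) \<in> Q" for H A
      using q \<A> \<B> by (auto simp: Q_def rows_def affine_pieces_def)
    show "\<exists>(H, A)\<in>Q. x \<in> solutions H" for x
    proof -
      obtain q p where "q \<in> \<A>" "x \<in> solutions (fst q)" "p \<in> \<B>" "x \<in> solutions (fst p)"
        using affine_pieces_cover[OF \<A>] affine_pieces_cover[OF \<B>] by blast
      then show ?thesis by (force simp: Q_def solutions_Un)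
    qed
    show "K > 0" using C(1) by (simp add: K_def add_pos_nonneg add_nonneg_pos)
    show "fst h \<bullet> x \<le> snd h + K * \<phi> x" if q: "(H, A) \<in> Q" and x: "x \<in> solutions H" and h: "h \<in> A"
      for H A x h
    proof -
      obtain S \<alpha> T \<beta> where *: "(S, \<alpha>) \<in> \<A>" "(T, \<beta>) \<in> \<B>" "H = S \<union> T" "A = rows \<alpha> \<beta>"
        using QE[OF q] by blast
      have xs: "x \<in> solutions S" "x \<in> solutions T" using x * by (auto simp: solutions_Un)
      consider i where "h = \<alpha> i" | i where "h = - \<alpha> i" | i where "h = \<beta> i"
        using h * unfolding rows_def by auto
      then show ?thesis
      proof cases
        case (1 i)
        then show ?thesis using Fi[OF *(1) xs(1), of i] F_le[of x i] by (auto simp: abs_le_iff)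
      next
        case (2 i)
        then show ?thesis using Fi[OF *(1) xs(1), of i] F_le[of x i] by (auto simp: abs_le_iff)
      next
        case (3 i)
        then show ?thesis using Gi[OF *(2) xs(2), of i] G_le[of x i] by auto
      qed
    qed
    show "\<phi> x \<le> K * r" if q: "(H, A) \<in> Q" and x: "x \<in> solutions H" and "0 \<le> r"
      and r: "\<forall>h\<in>A. fst h \<bullet> x \<le> snd h + r" for H A x r
    proof -
      obtain S \<alpha> T \<beta> where *: "(S, \<alpha>) \<in> \<A>" "(T, \<beta>) \<in> \<B>" "H = S \<union> T" "A = rows \<alpha> \<beta>"
        using QE[OF q] by blast
      have xs: "x \<in> solutions S" "x \<in> solutions T" using x * by (auto simp: solutions_Un)
      have "\<alpha> i \<in> A" "- \<alpha> i \<in> A" for i using * by (auto simp: rows_def)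
      from bspec[OF r this(1)] bspec[OF r this(2)]
      have "fst (\<alpha> i) \<bullet> x \<le> snd (\<alpha> i) + r" "fst (- \<alpha> i) \<bullet> x \<le> snd (- \<alpha> i) + r" for i .
      then have F: "\<bar>F x $ i\<bar> \<le> r" for i
        unfolding Fi[OF *(1) xs(1)] abs_le_iff by (simp add: algebra_simps)
      have "\<beta> i \<in> A" for i using * by (auto simp: rows_def)
      from bspec[OF r this] have "fst (\<beta> i) \<bullet> x \<le> snd (\<beta> i) + r" for i .
      then have G: "max (G x $ i) 0 \<le> r" for i
        unfolding Gi[OF *(2) xs(2)] using \<open>0 \<le> r\<close> by (simp add: algebra_simps)
      have "N (F x) \<le> C * norm (F x)" by (rule C)
      also have "\<dots> \<le> C * (\<Sum>i\<in>UNIV. \<bar>F x $ i\<bar>)"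
        using C(1) by (intro mult_left_mono norm_le_l1_cart) auto
      also have "\<dots> \<le> C * (\<Sum>i\<in>(UNIV :: 'm set). r)"
        using C(1) by (intro mult_left_mono sum_mono F) auto
      finally have "N (F x) \<le> C * CARD('m) * r" by simp
      moreover have "(\<Sum>i\<in>UNIV. max (G x $ i) 0) \<le> (\<Sum>i\<in>(UNIV :: 'n set). r)"
        by (intro sum_mono G)
      ultimately have "\<phi> x \<le> C * CARD('m) * r + CARD('n) * r" unfolding \<phi> by simp
      also have "\<dots> \<le> K * r" using C(1) \<open>0 \<le> r\<close> by (simp add: K_def algebra_simps)
      finally show ?thesis .
    qed
    show "L \<ge> 0" using C(1) LF LG by (simp add: L_def)
    show "\<phi> x \<le> \<phi> y + L * norm (x - y)" for x y
    proof -
      have "N (F x) \<le> N (F y) + C * norm (F x - F y)"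
        using is_norm_diff[OF N, of "F x" "F y"] C(2)[of "F x - F y"] by linarith
      also have "\<dots> \<le> N (F y) + C * (LF * norm (x - y))"
        using C(1) by (intro add_left_mono mult_left_mono LF) auto
      finally have "N (F x) \<le> N (F y) + C * (LF * norm (x - y))" .
      moreover have "max (G x $ i) 0 \<le> max (G y $ i) 0 + LG * norm (x - y)" for i
        using component_le_norm_cart[of "G x - G y" i] LG(2)[of x y] by simp
      then have "(\<Sum>i\<in>UNIV. max (G x $ i) 0) \<le> (\<Sum>i\<in>UNIV. max (G y $ i) 0 + LG * norm (x - y))"
        by (intro sum_mono)
      ultimately show ?thesis by (simp add: \<phi> L_def sum.distrib algebra_simps)
    qed
    show "\<exists>l. ((\<lambda>t. \<phi> (t *\<^sub>R x) / t) \<longlongrightarrow> l) at_top" for x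
    proof -
      obtain lF where lF: "((\<lambda>t. F (t *\<^sub>R x) /\<^sub>R t) \<longlongrightarrow> lF) at_top"
        using affine_pieces_ray_limit[OF \<A>] by blast
      obtain lG where lG: "((\<lambda>t. G (t *\<^sub>R x) /\<^sub>R t) \<longlongrightarrow> lG) at_top"
        using affine_pieces_ray_limit[OF \<B>] by blast
      have "((\<lambda>t. N (F (t *\<^sub>R x) /\<^sub>R t) + (\<Sum>i\<in>UNIV. max ((G (t *\<^sub>R x) /\<^sub>R t) $ i) 0))
        \<longlongrightarrow> N lF + (\<Sum>i\<in>UNIV. max (lG $ i) 0)) at_top"
        by (intro tendsto_intros continuous_on_tendsto_compose[OF is_norm_continuous[OF N] lF] lG) auto
      moreover have "\<forall>\<^sub>F t in at_top. N (F (t *\<^sub>R x) /\<^sub>R t) +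
        (\<Sum>i\<in>UNIV. max ((G (t *\<^sub>R x) /\<^sub>R t) $ i) 0) = \<phi> (t *\<^sub>R x) / t"
        using eventually_gt_at_top[of 0]
      proof eventually_elim
        case (elim t)
        then have "max ((G (t *\<^sub>R x) /\<^sub>R t) $ i) 0 = max (G (t *\<^sub>R x) $ i) 0 / t" for i
          by (auto simp: max_def field_simps)
        moreover have "N (F (t *\<^sub>R x) /\<^sub>R t) = N (F (t *\<^sub>R x)) / t"
          using elim by (simp add: N_scale field_simps)
        ultimately show ?case by (simp add: \<phi> add_divide_distrib sum_divide_distrib)
      qed
      ultimately have "((\<lambda>t. \<phi> (t *\<^sub>R x) / t)
        \<longlongrightarrow> N lF + (\<Sum>i\<in>UNIV. max (lG $ i) 0)) at_top"
        by (rule Lim_transform_eventually)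
      then show ?thesis by blast
    qed
    show "\<Omega> = {x. \<phi> x = 0}"
    proof -
      have "\<phi> x = 0 \<longleftrightarrow> N (F x) = 0 \<and> (\<Sum>i\<in>UNIV. max (G x $ i) 0) = 0" for x
        unfolding \<phi> by (intro add_nonneg_eq_0_iff N_nonneg sum_nonneg) auto
      moreover have "(\<Sum>i\<in>UNIV. max (G x $ i) 0) = 0 \<longleftrightarrow> (\<forall>i. G x $ i \<le> 0)" for x
        by (subst sum_nonneg_eq_0_iff) (auto simp: max_def)
      ultimately show ?thesis by (simp add: \<Omega>(1) N_zero)
    qed
  qed (fact \<phi>_nonneg \<Omega>)+
  then show ?thesis by blast
qed

section \<open>The sufficient conditions and their converses combined\<close>

theorem theorem10:
  fixes F :: "real ^ 'd \<Rightarrow> real ^ 'm"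
    and G :: "real ^ 'd \<Rightarrow> real ^ 'n"
    and Nd :: "real ^ 'd \<Rightarrow> real"
    and Nm :: "real ^ 'm \<Rightarrow> real"
    and V \<Omega> :: "(real ^ 'd) set"
    and \<phi> :: "real ^ 'd \<Rightarrow> real"
  assumes "is_norm Nd" and "is_norm Nm"
    and "piecewise_affine F" and "piecewise_affine G"
    and \<Omega>_def: "\<Omega> = {x. F x = 0 \<and> (\<forall>i. G x $ i \<le> 0)}"
    and "\<Omega> \<noteq> {}"
    and \<phi>_def: "\<phi> = (\<lambda>x. Nm (F x) + (\<Sum>i\<in>UNIV. max (G x $ i) 0))"
  shows
    "(norm_bounded Nd V
        \<or> (\<not> norm_bounded Nd V
            \<and> Liminf (at_infinity_within Nd V) (\<lambda>x. ereal (\<phi> x / Nd x)) > 0)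
        \<or> (nonempty_cone V \<and> coercive_on Nd V \<phi>)
        \<or> (V = UNIV \<and> positively_homogeneous F \<and> positively_homogeneous G)
        \<or> (finite_union_polyhedra V
            \<and> nonpos_set (recession_fun \<phi>) \<inter> recession_cone V \<subseteq> recession_cone \<Omega>)
      \<longrightarrow> (\<exists>\<tau>>0. error_bound Nd \<Omega> V \<phi> \<tau>))
     \<and> (finite_union_polyhedra V \<and> (\<exists>\<tau>>0. error_bound Nd \<Omega> V \<phi> \<tau>)
      \<longrightarrow> nonpos_set (recession_fun \<phi>) \<inter> recession_cone V \<subseteq> recession_cone \<Omega>)
     \<and> (recession_cone \<Omega> \<inter> closure (cone hull V) = {0} \<and> (\<exists>\<tau>>0. error_bound Nd \<Omega> V \<phi> \<tau>)
      \<longrightarrow> (\<not> norm_bounded Nd V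
            \<longrightarrow> Liminf (at_infinity_within Nd V) (\<lambda>x. ereal (\<phi> x / Nd x)) > 0)
        \<and> (nonempty_cone V \<longrightarrow> coercive_on Nd V \<phi>))"
proof -
  obtain Q K L where "polyhedral_residual \<phi> \<Omega> Q K L"
    using polyhedral_residual_piecewise_affine[OF assms(2-7)] by blast
  then interpret polyhedral_residual \<phi> \<Omega> Q K L .
  \<comment> \<open>Common form of the bounded, lower-limit and coercive cases; the last two
    conclusions of the theorem are read off from it as well.\<close>
  let ?growth = "\<exists>c>0. \<exists>R. \<forall>x\<in>V. R \<le> norm x \<longrightarrow> c * norm x \<le> \<phi> x"
  note eb_iff = ex_error_bound_iff[OF \<open>is_norm Nd\<close> \<open>\<Omega> \<noteq> {}\<close>]
  note liminf_iff = Liminf_pos_iff_linear_growth[OF \<open>is_norm Nd\<close>]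
  have bounded: ?growth if bounded: "norm_bounded Nd V"
  proof -
    obtain C where C: "C > 0" "\<And>x. Nd x \<le> C * norm x" "\<And>x. norm x \<le> C * Nd x"
      by (rule is_norm_equiv[OF \<open>is_norm Nd\<close>]) (rule that)
    obtain B where B: "\<And>x. x \<in> V \<Longrightarrow> Nd x \<le> B" using bounded unfolding norm_bounded_def by blast
    have "norm x < C * B + 1" if "x \<in> V" for x
      using C(3)[of x] mult_left_mono[OF B[OF that], of C] C(1) by linarith
    \<comment> \<open>Vacuous: no point of \<open>V\<close> lies that far out.\<close>
    then have "\<forall>x\<in>V. C * B + 1 \<le> norm x \<longrightarrow> 1 * norm x \<le> \<phi> x" by fastforce
    then show ?thesis by (meson zero_less_one)
  qed
  have homogeneous: "\<exists>\<tau>>0. \<forall>x\<in>V. \<tau> * infdist x \<Omega> \<le> \<phi> x"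
    if hom: "positively_homogeneous F" "positively_homogeneous G"
  proof -
    have "\<phi> (c *\<^sub>R x) = c * \<phi> x" if "c > 0" for c x
    proof -
      have "max (c * G x $ i) 0 = c * max (G x $ i) 0" for i
        using that by (auto simp: max_def mult_le_0_iff zero_le_mult_iff)
      moreover have "Nm (c *\<^sub>R F x) = c * Nm (F x)"
        using \<open>is_norm Nm\<close> that by (simp add: is_norm_def)
      ultimately show ?thesis
        using hom that by (simp add: positively_homogeneous_def \<phi>_def sum_distrib_left distrib_left)
    qed
    then show ?thesis using error_bound_homogeneous by blast
  qed
  have coercive: ?growth if "nonempty_cone V" "coercive_on Nd V \<phi>"
    using that coercive_on_lower_bound[OF \<open>is_norm Nd\<close>]
    by (intro linear_growth_of_coercive) (auto simp: nonempty_cone_def)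
  have sufficient: "\<exists>\<tau>>0. \<forall>x\<in>V. \<tau> * infdist x \<Omega> \<le> \<phi> x" if ?growth
    using that error_bound_linear_growth[where V = V] by blast
  have necessary: "nonpos_set (recession_fun \<phi>) \<inter> recession_cone V \<subseteq> recession_cone \<Omega>"
    if "\<exists>\<tau>>0. \<forall>x\<in>V. \<tau> * infdist x \<Omega> \<le> \<phi> x"
    using that recession_inclusion_of_error_bound[where V = V] by blast
  have growth: ?growth
    if "recession_cone \<Omega> \<inter> closure (cone hull V) = {0}"
      and "\<exists>\<tau>>0. \<forall>x\<in>V. \<tau> * infdist x \<Omega> \<le> \<phi> x"
    using that linear_growth_of_error_bound[where V = V] by blast
  have growth_coercive: "coercive_on Nd V \<phi>" if ?growth
    using that coercive_on_of_linear_growth[OF \<open>is_norm Nd\<close>, where V = V] by blast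
  \<comment> \<open>Once both equivalences are unfolded, what remains is propositional in the atoms
    shared with the collected facts.\<close>
  show ?thesis
    unfolding eb_iff liminf_iff
    using bounded homogeneous coercive sufficient error_bound_recession[of V]
      necessary growth growth_coercive
    by argo
qed

end
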